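(* Let $p$ be a prime, let $G$ be a locally compact abelian $p$-group with $\mathrm{rank}_p(G)<\infty$ and let $\phi\in\mathrm{End}(G)$. Then $h_{top}(\phi)=\log s(\phi)$.
   Context: For a topological group $G$, $\mathrm{End}(G)$ is the set of continuous endomorphisms of $G$. For a locally compact group $G$ with left Haar measure $\mu$, let $\mathcal C(G)$ be the family of compact neighborhoods of the identity. For $\phi\in\mathrm{End}(G)$, $U\in\mathcal C(G)$ and $n\ge 1$ put $C_n(\phi,U)=U\cap\phi^{-1}(U)\cap\dots\cap\phi^{-n+1}(U)$, $H_{top}(\phi,U)=\limsup_{n\to\infty}\frac{-\log\mu(C_n(\phi,U))}{n}$, and $h_{top}(\phi)=\sup\{H_{top}(\phi,U)\mid U\in\mathcal C(G)\}\in[0,\infty]$. For a totally disconnected locally compact group $G$ and $\phi\in\mathrm{End}(G)$, the scale of $\phi$ is $s(\phi)=\min\{[\phi(U):U\cap\phi(U)]\mid U \text{ a compact open subgroup of } G\}$. A locally compact abelian $p$-group is a locally compact abelian group $G$ in which $p^nx\to 0$ for every $x\in G$; it is a $\mathbb Z_p$-module with $\mathbb Z_p$-rank $\mathrm{rk}_{\mathbb Z_p}(G)$ and $p$-rank $r_p(G)=\dim_{\mathbb Z/p\mathbb Z}\{x\in G\mid px=0\}$. When both are finite, $\mathrm{rank}_p(G)=\mathrm{rk}_{\mathbb Z_p}(G)+r_p(G)$; $\mathrm{rank}_p(G)<\infty$ means that both are finite. It is a known theorem that this holds if and only if $G$ is topologically isomorphic to $\mathbb Z_p^{n_1}\times\mathbb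 Q_p^{n_2}\times\mathbb Z(p^\infty)^{n_3}\times F_p$ for some $n_1,n_2,n_3\in\mathbb N$ and a finite $p$-group $F_p$ (with $\mathbb Z_p,\mathbb Q_p$ carrying the $p$-adic topology and the Prüfer group $\mathbb Z(p^\infty)$ discrete); in particular such $G$ is totally disconnected. *)

theory Defs
  imports "HOL-Analysis.Analysis" "HOL-Computational_Algebra.Primes"
begin

text \<open>Groups are written additively; the library class of topological groups is not assumed
  commutative.\<close>

definition left_haar_measure :: "'a::{topological_group_add,t2_space} measure \<Rightarrow> bool" where
  "left_haar_measure \<mu> \<longleftrightarrow>
     sets \<mu> = sets borel \<and>
     emeasure \<mu> (space \<mu>) \<noteq> 0 \<and>
     (\<forall>K. compact K \<longrightarrow> emeasure \<mu> K < \<infinity>) \<and>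
     (\<forall>A\<in>sets borel. emeasure \<mu> A = (INF V\<in>{V. open V \<and> A \<subseteq> V}. emeasure \<mu> V)) \<and>
     (\<forall>V. open V \<longrightarrow> emeasure \<mu> V = (SUP K\<in>{K. compact K \<and> K \<subseteq> V}. emeasure \<mu> K)) \<and>
     (\<forall>x. \<forall>A\<in>sets borel. emeasure \<mu> ((\<lambda>y. x + y) ` A) = emeasure \<mu> A)"

definition cont_endomorphisms :: "('a::topological_group_add \<Rightarrow> 'a) set" where
  "cont_endomorphisms = {\<phi>. (\<forall>x y. \<phi> (x + y) = \<phi> x + \<phi> y) \<and> continuous_on UNIV \<phi>}"

definition compact_nhds_0 :: "'a::topological_group_add set set" where
  "compact_nhds_0 = {U. compact U \<and> 0 \<in> interior U}"

definition cotrajectory :: "('a \<Rightarrow> 'a) \<Rightarrow> 'a set \<Rightarrow> nat \<Rightarrow> 'a set" where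
  "cotrajectory \<phi> U n = (\<Inter>i<n. (\<phi> ^^ i) -` U)"

text \<open>For U a compact neighbourhood of 0 and n > 0 the measure below is positive and finite, so
  the real-valued measure and logarithm are the intended ones; the term n = 0 is irrelevant.\<close>

definition H_top :: "'a::{topological_group_add,t2_space} measure \<Rightarrow> ('a \<Rightarrow> 'a) \<Rightarrow> 'a set \<Rightarrow> ereal"
  where "H_top \<mu> \<phi> U = limsup (\<lambda>n. ereal (- ln (measure \<mu> (cotrajectory \<phi> U n)) / real n))"

definition h_top :: "'a::{topological_group_add,t2_space} measure \<Rightarrow> ('a \<Rightarrow> 'a) \<Rightarrow> ereal" where
  "h_top \<mu> \<phi> = (SUP U\<in>compact_nhds_0. H_top \<mu> \<phi> U)"

definition compact_open_subgroup :: "'a::topological_group_add set \<Rightarrow> bool" where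
  "compact_open_subgroup U \<longleftrightarrow>
     compact U \<and> open U \<and> 0 \<in> U \<and> (\<forall>x\<in>U. \<forall>y\<in>U. x + y \<in> U) \<and> (\<forall>x\<in>U. - x \<in> U)"

definition subgroup_index :: "'a::group_add set \<Rightarrow> 'a set \<Rightarrow> nat" where
  "subgroup_index H K = card ((\<lambda>x. (\<lambda>y. x + y) ` K) ` H)"

text \<open>The index is always finite here, so that the convention that infinite sets have cardinality 0
  does not interfere: the image of U is compact and its intersection with U is relatively open.
  The infimum of a nonempty set of natural numbers is its minimum.\<close>

definition endo_scale :: "('a::topological_group_add \<Rightarrow> 'a) \<Rightarrow> nat" where
  "endo_scale \<phi> = Inf {subgroup_index (\<phi> ` U) (U \<inter> \<phi> ` U) | U. compact_open_subgroup U}"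

definition nat_mult :: "nat \<Rightarrow> 'a::monoid_add \<Rightarrow> 'a" where
  "nat_mult n x = ((\<lambda>y. x + y) ^^ n) 0"

definition lca_p_group :: "nat \<Rightarrow> 'a::{topological_ab_group_add,t2_space} itself \<Rightarrow> bool" where
  "lca_p_group p _ \<longleftrightarrow>
     locally_compact_space (euclidean :: 'a topology) \<and>
     (\<forall>x::'a. (\<lambda>n. nat_mult (p ^ n) x) \<longlonglongrightarrow> 0)"

text \<open>The p-adic integers as the inverse limit of the rings of residues modulo the powers of p:
  the n-th entry is the representative modulo p to the n. The zero element is the constant
  sequence 0.\<close>

definition padic_ints :: "nat \<Rightarrow> (nat \<Rightarrow> nat) set" where
  "padic_ints p = {a. \<forall>n. a n < p ^ n \<and> a (Suc n) mod p ^ n = a n}"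

text \<open>The action of the p-adic integers on a locally compact abelian p-group: the continuous
  extension of the action of the integers. The limit exists because the closure of a cyclic
  subgroup is a finite cyclic p-group or a copy of the p-adic integers.\<close>

definition padic_scale :: "(nat \<Rightarrow> nat) \<Rightarrow> 'a::{topological_ab_group_add,t2_space} \<Rightarrow> 'a" where
  "padic_scale a x = lim (\<lambda>n. nat_mult (a n) x)"

text \<open>Linear independence over scalars R with zero element z acting by s. The rank of a module
  over a domain (its dimension, over a field) is the supremum of the sizes of its finite linearly
  independent subsets.\<close>

definition lin_indep :: "'r set \<Rightarrow> 'r \<Rightarrow> ('r \<Rightarrow> 'a \<Rightarrow> 'a) \<Rightarrow> 'a::comm_monoid_add set \<Rightarrow> bool" where
  "lin_indep R z s B \<longleftrightarrow> finite B \<and>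
     (\<forall>c. (\<forall>b\<in>B. c b \<in> R) \<longrightarrow> (\<Sum>b\<in>B. s (c b) b) = 0 \<longrightarrow> (\<forall>b\<in>B. c b = z))"

definition lin_rank :: "'r set \<Rightarrow> 'r \<Rightarrow> ('r \<Rightarrow> 'a \<Rightarrow> 'a) \<Rightarrow> 'a::comm_monoid_add set \<Rightarrow> enat" where
  "lin_rank R z s M = (SUP B\<in>{B. B \<subseteq> M \<and> lin_indep R z s B}. enat (card B))"

definition Zp_rank :: "nat \<Rightarrow> 'a::{topological_ab_group_add,t2_space} itself \<Rightarrow> enat" where
  "Zp_rank p _ = lin_rank (padic_ints p) (\<lambda>_. 0) padic_scale (UNIV :: 'a set)"

text \<open>The field with p elements is represented by the residues 0, ..., p - 1.\<close>

definition socle_rank :: "nat \<Rightarrow> 'a::ab_group_add itself \<Rightarrow> enat" where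
  "socle_rank p _ = lin_rank {..<p} 0 nat_mult {x::'a. nat_mult p x = 0}"

text \<open>In the extended natural numbers the sum is finite iff both summands are.\<close>

definition rank_p :: "nat \<Rightarrow> 'a::{topological_ab_group_add,t2_space} itself \<Rightarrow> enat" where
  "rank_p p t = Zp_rank p t + socle_rank p t"

end

theory Submission
  imports Defs
begin

text \<open>
Write \<open>C\<^sub>n(U)\<close> for the n-th cotrajectory of U, where \<open>n \<ge> 1\<close>. For a compact open subgroup U,
\<open>\<phi>\<close> identifies the index \<open>[\<phi> U : U \<inter> \<phi> U]\<close> with
\<open>[U : U \<inter> \<phi>\<^sup>-\<^sup>1 U]\<close>, and
\<open>C\<^sub>n\<^sub>+\<^sub>1(U) = C\<^sub>n(U) \<inter> \<phi>\<^sup>-\<^sup>1 C\<^sub>n(U)\<close>. The ratio of the measures of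
\<open>C\<^sub>n(U)\<close> and \<open>C\<^sub>n\<^sub>+\<^sub>1(U)\<close> is therefore the index that the scale associates
with the compact open subgroup \<open>C\<^sub>n(U)\<close>. It is at least the scale s, so the entropy relative to U is
at least \<open>ln s\<close> (\<open>H_top_ge_ln_scale\<close>).

For the converse take V with \<open>[V : V \<inter> \<phi>\<^sup>-\<^sup>1 V] = s\<close>. The map \<open>\<phi>\<^sup>n\<close> sends the
\<open>(n + 1)\<close>-st cotrajectory of V into V, so the index of the following cotrajectory in it is at most s,
and the entropy relative to V is at most \<open>ln s\<close>. It remains to pass from V to an arbitrary compact
neighbourhood U of 0. Some \<open>p\<^sup>k V\<close> lies in U, and then \<open>p\<^sup>k C\<^sub>n(V) \<subseteq> C\<^sub>n(U)\<close>
because \<open>\<phi>\<close> commutes with multiplication by p. If the index of \<open>p\<^sup>k C\<^sub>n(V)\<close> in \<open>C\<^sub>n(V)\<close>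
is bounded independently of n, the measure of \<open>C\<^sub>n(U)\<close> is at least a constant multiple
of that of \<open>C\<^sub>n(V)\<close>, and the constant disappears in the limit (\<open>H_top_le_ln_scale\<close>).

This uniform bound is where the finite rank is used (\<open>covered_by_multiples_uniform\<close>).
The group has finitely many elements of order p, so some \<open>p\<^sup>k V\<close> is torsion-free. For a torsion-free compact subgroup W, elements
independent modulo \<open>p W\<close> are independent over the p-adic integers, so \<open>W / p W\<close> has
at most \<open>p\<^sup>m\<close> elements, m being the p-adic rank. Dividing by p multiplies this bound by at most the
number of elements of order p, and k divisions lead from \<open>p\<^sup>k W\<close> back to W.

The topological input is the uniformity of
\<open>p\<^sup>n x \<longlonglongrightarrow> 0\<close> on compact sets, a consequence of the Baire category theorem
(\<open>prime_powers_tendsto_uniformly\<close>), together with the existence of one compact open subgroup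
(\<open>compact_open_subgroup_exists\<close>).
\<close>

section \<open>Subgroups and multiples\<close>

definition additive_subgroup :: "'a::group_add set \<Rightarrow> bool" where
  "additive_subgroup H \<longleftrightarrow> 0 \<in> H \<and> (\<forall>x\<in>H. \<forall>y\<in>H. x - y \<in> H)"

lemma additive_subgroup_zero: "additive_subgroup H \<Longrightarrow> 0 \<in> H"
  and additive_subgroup_diff: "additive_subgroup H \<Longrightarrow> x \<in> H \<Longrightarrow> y \<in> H \<Longrightarrow> x - y \<in> H"
  by (auto simp: additive_subgroup_def)

lemma additive_subgroup_minus: "additive_subgroup H \<Longrightarrow> x \<in> H \<Longrightarrow> - x \<in> H"
  using additive_subgroup_diff[of H 0 x] by (auto simp: additive_subgroup_def)

lemma additive_subgroup_add: "additive_subgroup H \<Longrightarrow> x \<in> H \<Longrightarrow> y \<in> H \<Longrightarrow> x + y \<in> H"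
  using additive_subgroup_diff[of H x "- y"] by (simp add: additive_subgroup_minus)

lemma additive_subgroup_sum:
  fixes H :: "'a::ab_group_add set"
  assumes "additive_subgroup H" "\<And>b. b \<in> B \<Longrightarrow> g b \<in> H"
  shows "(\<Sum>b\<in>B. g b) \<in> H"
  using assms(2)
  by (induction B rule: infinite_finite_induct)
     (auto simp: additive_subgroup_zero[OF assms(1)] additive_subgroup_add[OF assms(1)])

lemma compact_open_subgroup_iff:
  "compact_open_subgroup U \<longleftrightarrow> compact U \<and> open U \<and> additive_subgroup U"
proof
  assume "compact U \<and> open U \<and> additive_subgroup U"
  then show "compact_open_subgroup U"
    using additive_subgroup_add[of U] additive_subgroup_minus[of U]
    by (auto simp: compact_open_subgroup_def additive_subgroup_zero)
next
  assume U: "compact_open_subgroup U"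
  have "x - y \<in> U" if "x \<in> U" "y \<in> U" for x y
    using U that unfolding compact_open_subgroup_def diff_conv_add_uminus by blast
  with U show "compact U \<and> open U \<and> additive_subgroup U"
    by (auto simp: compact_open_subgroup_def additive_subgroup_def)
qed

lemma nat_mult_0 [simp]: "nat_mult 0 x = 0"
  and nat_mult_Suc: "nat_mult (Suc n) x = x + nat_mult n x"
  by (simp_all add: nat_mult_def)

lemma nat_mult_zero [simp]: "nat_mult n 0 = (0::'a::monoid_add)"
  by (induction n) (simp_all add: nat_mult_Suc)

lemma nat_mult_1 [simp]: "nat_mult (Suc 0) x = (x::'a::monoid_add)"
  by (simp add: nat_mult_Suc)

lemma nat_mult_plus: "nat_mult (m + n) x = nat_mult m x + nat_mult n (x::'a::monoid_add)"
  by (induction m) (simp_all add: nat_mult_Suc add.assoc)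

lemma nat_mult_times: "nat_mult (m * n) x = nat_mult m (nat_mult n (x::'a::monoid_add))"
  by (induction m) (simp_all add: nat_mult_Suc nat_mult_plus)

lemma nat_mult_add: "nat_mult n (x + y) = nat_mult n x + nat_mult n (y::'a::comm_monoid_add)"
  by (induction n) (simp_all add: nat_mult_Suc algebra_simps)

lemma nat_mult_minus: "nat_mult n (- x) = - nat_mult n (x::'a::ab_group_add)"
  by (induction n) (simp_all add: nat_mult_Suc)

lemma nat_mult_diff: "nat_mult n (x - y) = nat_mult n x - nat_mult n (y::'a::ab_group_add)"
  using nat_mult_add[of n x "- y"] by (simp add: nat_mult_minus)

lemma nat_mult_sum: "nat_mult n (\<Sum>b\<in>B. g b) = (\<Sum>b\<in>B. nat_mult n (g b :: 'a::comm_monoid_add))"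
  by (induction B rule: infinite_finite_induct) (simp_all add: nat_mult_add)

lemma nat_mult_hom:
  fixes \<phi> :: "'a::group_add \<Rightarrow> 'b::group_add"
  assumes "\<And>x y. \<phi> (x + y) = \<phi> x + \<phi> y"
  shows "\<phi> (nat_mult n x) = nat_mult n (\<phi> x)"
proof (induction n)
  case 0
  have "\<phi> 0 + \<phi> 0 = \<phi> 0 + 0" using assms[of 0 0] by simp
  then show ?case by (simp only: add_left_cancel nat_mult_0)
qed (simp add: nat_mult_Suc assms)

lemma nat_mult_in_subgroup: "additive_subgroup H \<Longrightarrow> x \<in> H \<Longrightarrow> nat_mult n x \<in> H"
  by (induction n) (auto simp: nat_mult_Suc additive_subgroup_zero additive_subgroup_add)

lemma additive_subgroup_nat_mult:
  fixes H :: "'a::ab_group_add set"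
  assumes "additive_subgroup H"
  shows "additive_subgroup (nat_mult n ` H)"
  unfolding additive_subgroup_def
proof (intro conjI ballI)
  show "0 \<in> nat_mult n ` H"
    using additive_subgroup_zero[OF assms] by (metis image_eqI nat_mult_zero)
  fix x y assume "x \<in> nat_mult n ` H" "y \<in> nat_mult n ` H"
  then obtain u v where "u \<in> H" "v \<in> H" "x = nat_mult n u" "y = nat_mult n v" by auto
  then show "x - y \<in> nat_mult n ` H"
    using additive_subgroup_diff[OF assms] by (metis image_eqI nat_mult_diff)
qed

lemma continuous_nat_mult: "continuous_on S (nat_mult n :: 'a \<Rightarrow> 'a::topological_monoid_add)"
proof (induction n)
  case 0
  have "nat_mult 0 = (\<lambda>_. 0 :: 'a)" by (rule ext) simp
  then show ?case by simp
next
  case (Suc n)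
  have "nat_mult (Suc n) = (\<lambda>x. x + nat_mult n x :: 'a)" by (rule ext) (rule nat_mult_Suc)
  then show ?case using Suc by (simp only:) (intro continuous_intros)
qed

lemma compact_nat_mult: "compact K \<Longrightarrow> compact (nat_mult n ` (K :: 'a::topological_monoid_add set))"
  by (intro compact_continuous_image continuous_nat_mult)

section \<open>Neighbourhoods of zero and uniform convergence of the prime powers\<close>

lemma nbhd_0_add:
  fixes N :: "'a::topological_group_add set"
  assumes "open N" "0 \<in> N"
  obtains A where "open A" "0 \<in> A" "\<And>x. x \<in> A \<Longrightarrow> - x \<in> A" "\<And>x y. x \<in> A \<Longrightarrow> y \<in> A \<Longrightarrow> x + y \<in> N"
proof -
  have "open ((\<lambda>z. fst z + snd z) -` N)"
    by (intro open_vimage assms continuous_intros)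
  moreover have "(0, 0) \<in> (\<lambda>z. fst z + snd z) -` N" using assms by simp
  ultimately obtain B C where BC: "open B" "open C" "0 \<in> B" "0 \<in> C"
    and sub: "B \<times> C \<subseteq> (\<lambda>z. fst z + snd z) -` N"
    by (elim open_prod_elim) auto
  define A where "A = (B \<inter> C) \<inter> uminus -` (B \<inter> C)"
  show ?thesis
  proof (rule that[of A])
    show "open A" unfolding A_def
      by (intro open_Int open_vimage BC continuous_intros)
    show "0 \<in> A" using BC by (simp add: A_def)
    show "- x \<in> A" if "x \<in> A" for x using that by (simp add: A_def)
    show "x + y \<in> N" if "x \<in> A" "y \<in> A" for x y
      using that sub by (auto simp: A_def)
  qed
qed

lemma open_translate:
  fixes A :: "'a::topological_group_add set"
  shows "open A \<Longrightarrow> open ((\<lambda>z. z - x) -` A)"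
  by (intro open_vimage continuous_intros)

lemma compact_finite_cover_translates:
  fixes K :: "'a::topological_group_add set"
  assumes "compact K" "open A" "0 \<in> A"
  obtains X where "finite X" "X \<subseteq> K" "\<And>z. z \<in> K \<Longrightarrow> \<exists>x\<in>X. z - x \<in> A"
proof -
  have K: "K \<subseteq> (\<Union>x\<in>K. (\<lambda>z. z - x) -` A)" using assms(3) by auto
  obtain X where X: "X \<subseteq> K" "finite X" "K \<subseteq> (\<Union>x\<in>X. (\<lambda>z. z - x) -` A)"
    by (rule compactE_image[OF assms(1) open_translate[OF assms(2)] K])
  show ?thesis
  proof (rule that[OF X(2,1)])
    fix z assume "z \<in> K"
    then show "\<exists>x\<in>X. z - x \<in> A" using X(3) by auto
  qed
qed

lemma closure_subset_nbhd:
  fixes A :: "'a::topological_group_add set"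
  assumes "open A" "0 \<in> A" "\<And>x. x \<in> A \<Longrightarrow> - x \<in> A" "\<And>x y. x \<in> A \<Longrightarrow> y \<in> A \<Longrightarrow> x + y \<in> N"
  shows "closure A \<subseteq> N"
proof
  fix x assume "x \<in> closure A"
  moreover have "open ((\<lambda>z. z - x) -` A)" "x \<in> (\<lambda>z. z - x) -` A"
    using open_translate[OF assms(1)] assms(2) by simp_all
  ultimately have "(\<lambda>z. z - x) -` A \<inter> A \<noteq> {}"
    using open_Int_closure_eq_empty[of "(\<lambda>z. z - x) -` A" A] by blast
  then obtain y where "y \<in> A" "y - x \<in> A" by blast
  then have "- (y - x) + y \<in> N" using assms(4)[OF assms(3)] by blast
  then show "x \<in> N" by simp
qed

text \<open>The pointwise convergence of \<open>p ^ n x\<close> to 0 is uniform on compact sets: by the Baire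
category theorem the multiplications by high powers of p are equicontinuous at 0.\<close>

lemma prime_powers_tendsto_uniformly:
  fixes K :: "'a::{topological_ab_group_add,t2_space} set"
  assumes G: "lca_p_group p TYPE('a)" and "compact K" "open N" "0 \<in> N"
  shows "\<exists>n0. \<forall>n\<ge>n0. \<forall>x\<in>K. nat_mult (p ^ n) x \<in> N"
proof -
  have lc: "locally_compact_space (euclidean :: 'a topology)"
    and lim: "(\<lambda>n. nat_mult (p ^ n) x) \<longlonglongrightarrow> 0" for x :: 'a
    using G by (auto simp: lca_p_group_def)
  obtain M where M: "open M" "0 \<in> M" "\<And>x. x \<in> M \<Longrightarrow> - x \<in> M" "\<And>x y. x \<in> M \<Longrightarrow> y \<in> M \<Longrightarrow> x + y \<in> N"
    using nbhd_0_add[OF assms(3,4)] by blast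
  obtain A where A: "open A" "0 \<in> A" "\<And>x. x \<in> A \<Longrightarrow> - x \<in> A" "\<And>x y. x \<in> A \<Longrightarrow> y \<in> A \<Longrightarrow> x + y \<in> M"
    using nbhd_0_add[OF M(1,2)] by blast
  obtain B where B: "open B" "0 \<in> B" "\<And>x. x \<in> B \<Longrightarrow> - x \<in> B" "\<And>x y. x \<in> B \<Longrightarrow> y \<in> B \<Longrightarrow> x + y \<in> A"
    using nbhd_0_add[OF A(1,2)] by blast
  have clB: "closure B \<subseteq> A" using closure_subset_nbhd[OF B] .
  \<comment> \<open>The closed sets \<open>Q n\<close> exhaust the group because every orbit under multiplication by p
    tends to 0, so by Baire one of them has an interior point; differences with that point give a
    neighbourhood of 0 on which all high powers of p are small at once.\<close>
  define Q where "Q n = (\<Inter>k\<in>{n..}. nat_mult (p ^ k) -` closure B)" for n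
  have Q_closed: "closed (Q n)" for n
    unfolding Q_def by (intro closed_INT ballI closed_vimage closed_closure continuous_nat_mult)
  have "x \<in> (\<Union>n. Q n)" for x
  proof -
    have "\<forall>\<^sub>F n in sequentially. nat_mult (p ^ n) x \<in> B"
      using topological_tendstoD[OF lim B(1,2)] .
    then show ?thesis using closure_subset[of B] by (auto simp: Q_def eventually_sequentially)
  qed
  then have UnQ: "\<Union> (range Q) = UNIV" by auto
  have "\<exists>n. interior (Q n) \<noteq> {}"
  proof (rule ccontr)
    assume "\<not> ?thesis"
    moreover have "Hausdorff_space (euclidean :: 'a topology)"
      unfolding Hausdorff_space_def by (auto simp: disjnt_def dest!: hausdorff)
    then have "regular_space (euclidean :: 'a topology)"
      using lc locally_compact_Hausdorff_imp_regular_space by blast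
    ultimately have "euclidean interior_of \<Union> (range Q) = {}"
      using lc Q_closed by (intro Baire_category_alt) auto
    then show False using UnQ by simp
  qed
  then obtain m x0 where x0: "x0 \<in> interior (Q m)" by blast
  define D where "D = (\<lambda>y. x0 + y) -` interior (Q m)"
  have D: "open D" "0 \<in> D"
    using x0 by (auto simp: D_def intro!: open_vimage continuous_intros)
  have DM: "nat_mult (p ^ k) y \<in> M" if "y \<in> D" "k \<ge> m" for y k
  proof -
    have "x0 + y \<in> Q m" "x0 \<in> Q m" using that x0 interior_subset by (auto simp: D_def)
    then have "nat_mult (p ^ k) (x0 + y) \<in> A" "nat_mult (p ^ k) x0 \<in> A"
      using that clB by (auto simp: Q_def)
    then have "nat_mult (p ^ k) (x0 + y) + - nat_mult (p ^ k) x0 \<in> M" using A by blast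
    then show ?thesis by (simp add: nat_mult_add)
  qed
  obtain X where X: "finite X" "\<And>z. z \<in> K \<Longrightarrow> \<exists>x\<in>X. z - x \<in> D"
    using compact_finite_cover_translates[OF assms(2) D] by metis
  have "\<forall>x\<in>X. \<forall>\<^sub>F n in sequentially. nat_mult (p ^ n) x \<in> M"
    using topological_tendstoD[OF lim M(1,2)] by blast
  then have "\<forall>\<^sub>F n in sequentially. \<forall>x\<in>X. nat_mult (p ^ n) x \<in> M"
    by (rule eventually_ball_finite[OF X(1)])
  then have "\<forall>\<^sub>F n in sequentially. n \<ge> m \<and> (\<forall>x\<in>X. nat_mult (p ^ n) x \<in> M)"
    using eventually_ge_at_top[of m] by eventually_elim simp
  then obtain n0 where n0: "\<And>n. n \<ge> n0 \<Longrightarrow> n \<ge> m \<and> (\<forall>x\<in>X. nat_mult (p ^ n) x \<in> M)"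
    unfolding eventually_sequentially by blast
  have "nat_mult (p ^ n) z \<in> N" if n: "n \<ge> n0" and z: "z \<in> K" for n z
  proof -
    obtain x where x: "x \<in> X" "z - x \<in> D" using X(2)[OF z] by blast
    then have "nat_mult (p ^ n) x + nat_mult (p ^ n) (z - x) \<in> N"
      using n0[OF n] DM n M(4) by (meson order_trans)
    then show ?thesis by (simp flip: nat_mult_add)
  qed
  then show ?thesis by blast
qed

lemma lca_p_group_compact_nbhd:
  assumes "lca_p_group p TYPE('a::{topological_ab_group_add,t2_space})"
  obtains U L :: "'a::{topological_ab_group_add,t2_space} set"
    where "open U" "compact L" "0 \<in> U" "U \<subseteq> L"
proof -
  have lc: "locally_compact_space (euclidean :: 'a topology)"
    using assms by (simp add: lca_p_group_def)
  have "0 \<in> topspace (euclidean :: 'a topology)" by simp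
  from lc[unfolded locally_compact_space_def, rule_format, OF this] show ?thesis
    using that by auto
qed

section \<open>Compact open subgroups\<close>

text \<open>A special case of Weil's lemma on monothetic groups. A cyclic group whose generator f satisfies
\<open>p ^ n f \<longlonglongrightarrow> 0\<close> has positive multiples of f near each of its elements. For a compact
neighbourhood K of 0 this bounds the least n with \<open>n f \<in> a + K\<close> independently of a,
so finitely many translates of \<open>- K\<close> cover the group.\<close>

lemma cyclic_relatively_compact:
  fixes f :: "'a::{topological_ab_group_add,t2_space}"
  assumes G: "lca_p_group p TYPE('a)" and "prime p"
  obtains C where "compact C" "\<And>m n. nat_mult m f - nat_mult n f \<in> C"
proof -
  have lim: "(\<lambda>n. nat_mult (p ^ n) x) \<longlonglongrightarrow> 0" for x :: 'a
    using G by (auto simp: lca_p_group_def)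
  obtain O' K :: "'a set" where K: "open O'" "compact K" "0 \<in> O'" "O' \<subseteq> K"
    by (rule lca_p_group_compact_nbhd[OF G])
  obtain A where A: "open A" "0 \<in> A" "\<And>x. x \<in> A \<Longrightarrow> - x \<in> A" "\<And>x y. x \<in> A \<Longrightarrow> y \<in> A \<Longrightarrow> x + y \<in> O'"
    using nbhd_0_add[OF K(1,3)] by blast
  obtain B where B: "open B" "0 \<in> B" "\<And>x. x \<in> B \<Longrightarrow> - x \<in> B" "\<And>x y. x \<in> B \<Longrightarrow> y \<in> B \<Longrightarrow> x + y \<in> A"
    using nbhd_0_add[OF A(1,2)] by blast
  define Z where "Z = {nat_mult m f - nat_mult n f | m n. True}"
  have Zd: "x - y \<in> Z" if "x \<in> Z" "y \<in> Z" for x y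
  proof -
    obtain a b c d where "x = nat_mult a f - nat_mult b f" "y = nat_mult c f - nat_mult d f"
      using \<open>x \<in> Z\<close> \<open>y \<in> Z\<close> unfolding Z_def by auto
    then have "x - y = nat_mult (a + d) f - nat_mult (b + c) f"
      by (simp add: nat_mult_plus)
    then show ?thesis unfolding Z_def by blast
  qed
  have Z1: "nat_mult n f \<in> Z" for n
    unfolding Z_def by simp (metis diff_zero nat_mult_0)
  \<comment> \<open>Adding a high power of p to a coefficient hardly moves the multiple of f but makes the
    coefficient positive.\<close>
  have dense: "\<exists>n>0. nat_mult n f - y \<in> B" if y: "y \<in> Z" for y
  proof -
    obtain a b where yab: "y = nat_mult a f - nat_mult b f" using y by (auto simp: Z_def)
    have "\<forall>\<^sub>F n in sequentially. nat_mult (p ^ n) f \<in> B"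
      using topological_tendstoD[OF lim B(1,2)] .
    then have "\<forall>\<^sub>F n in sequentially. n \<ge> b \<and> nat_mult (p ^ n) f \<in> B"
      using eventually_ge_at_top[of b] by eventually_elim simp
    then obtain n where n: "n \<ge> b" "nat_mult (p ^ n) f \<in> B"
      by (metis (no_types, lifting) eventually_sequentially order_refl)
    have "n < p ^ n" using prime_gt_1_nat[OF \<open>prime p\<close>] by (intro power_gt_expt) simp
    then have "p ^ n > b" using n by simp
    have "nat_mult (a + (p ^ n - b)) f + nat_mult b f = nat_mult a f + nat_mult (p ^ n) f"
      using \<open>p ^ n > b\<close> by (simp flip: nat_mult_plus)
    then have "nat_mult (a + (p ^ n - b)) f - y = nat_mult (p ^ n) f"
      by (simp add: yab algebra_simps)
    then show ?thesis using n \<open>p ^ n > b\<close> by (intro exI[of _ "a + (p ^ n - b)"]) simp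
  qed
  obtain X where X: "finite X" "X \<subseteq> K" "\<And>z. z \<in> K \<Longrightarrow> \<exists>x\<in>X. z - x \<in> B"
    using compact_finite_cover_translates[OF K(2) B(1,2)] by metis
  \<comment> \<open>Each of the finitely many small pieces that cover K thus has a positive multiple of f
    near all its elements of Z.\<close>
  have "\<exists>n>0. \<forall>z\<in>Z. z - x \<in> B \<longrightarrow> z - nat_mult n f \<in> K" for x
  proof (cases "\<exists>y\<in>Z. y - x \<in> B")
    case True
    then obtain y where y: "y \<in> Z" "y - x \<in> B" by blast
    obtain n where n: "n > 0" "nat_mult n f - y \<in> B" using dense[OF y(1)] by blast
    have "z - nat_mult n f \<in> K" if "z - x \<in> B" for z
    proof -
      have 1: "(z - x) + - (y - x) \<in> A" using that y B by blast
      have "- (nat_mult n f - y) + 0 \<in> A" using n B by blast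
      with 1 have "((z - x) + - (y - x)) + (- (nat_mult n f - y) + 0) \<in> O'" using A by blast
      moreover have "((z - x) + - (y - x)) + (- (nat_mult n f - y) + 0) = z - nat_mult n f"
        by (simp add: algebra_simps)
      ultimately show ?thesis using K(4) by auto
    qed
    with n(1) show ?thesis by blast
  next
    case False
    then show ?thesis by (intro exI[of _ 1]) auto
  qed
  then obtain h where h: "\<And>x. h x > 0" "\<And>x z. z \<in> Z \<Longrightarrow> z - x \<in> B \<Longrightarrow> z - nat_mult (h x) f \<in> K"
    by metis
  define M where "M = Max (insert 0 (h ` X))"
  have hM: "h x \<le> M" if "x \<in> X" for x
    unfolding M_def using X(1) that by (intro Max_ge) auto
  have 2: "\<exists>n\<le>M. nat_mult n f - a \<in> K" if a: "a \<in> Z" for a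
  proof -
    have "\<exists>n. nat_mult n f - a \<in> K"
    proof -
      obtain n where n: "nat_mult n f - a \<in> B" using dense[OF a] by blast
      then have "nat_mult n f - a \<in> A" using B(4)[OF n B(2)] by simp
      then have "nat_mult n f - a \<in> O'" using A(4)[OF _ A(2)] by fastforce
      then show ?thesis using K(4) by blast
    qed
    \<comment> \<open>If the least n were at least \<open>h x\<close>, subtracting \<open>h x\<close> from it would leave
      the difference in K, against minimality.\<close>
    define n where "n = (LEAST n. nat_mult n f - a \<in> K)"
    have n: "nat_mult n f - a \<in> K" unfolding n_def by (rule LeastI_ex) fact
    obtain x where x: "x \<in> X" "nat_mult n f - a - x \<in> B" using X(3)[OF n] by blast
    have "n < h x"
    proof (rule ccontr)
      assume "\<not> n < h x"
      have "nat_mult n f - a - nat_mult (h x) f \<in> K"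
        by (rule h(2)[OF Zd[OF Z1 a] x(2)])
      moreover have "nat_mult (n - h x) f + nat_mult (h x) f = nat_mult n f"
        using \<open>\<not> n < h x\<close> by (simp flip: nat_mult_plus)
      then have "nat_mult n f - a - nat_mult (h x) f = nat_mult (n - h x) f - a"
        by (simp add: algebra_simps)
      ultimately have "nat_mult (n - h x) f - a \<in> K" by simp
      then have "n \<le> n - h x" unfolding n_def by (rule Least_le)
      then show False using h(1)[of x] \<open>\<not> n < h x\<close> by simp
    qed
    then show ?thesis using n hM[OF x(1)] by (intro exI[of _ n]) auto
  qed
  define C where "C = (\<Union>n\<le>M. (\<lambda>z. nat_mult n f - z) ` K)"
  show ?thesis
  proof (rule that[of C])
    show "compact C" unfolding C_def
      by (intro compact_UN finite_atMost compact_continuous_image continuous_intros K)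
    fix m n
    have "nat_mult m f - nat_mult n f \<in> Z" by (auto simp: Z_def)
    then obtain k where k: "k \<le> M" "nat_mult k f - (nat_mult m f - nat_mult n f) \<in> K" using 2 by blast
    have "nat_mult m f - nat_mult n f = nat_mult k f - (nat_mult k f - (nat_mult m f - nat_mult n f))"
      by (simp add: algebra_simps)
    then show "nat_mult m f - nat_mult n f \<in> C" unfolding C_def using k by blast
  qed
qed

lemma compact_set_plus:
  fixes A B :: "'a::topological_monoid_add set"
  assumes "compact A" "compact B"
  shows "compact {x + y | x y. x \<in> A \<and> y \<in> B}"
proof -
  have "compact ((\<lambda>z. fst z + snd z) ` (A \<times> B))"
    by (intro compact_continuous_image continuous_intros compact_Times assms)
  moreover have "(\<lambda>z. fst z + snd z) ` (A \<times> B) = {x + y | x y. x \<in> A \<and> y \<in> B}" by force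
  ultimately show ?thesis by simp
qed

lemma set_plus_superset:
  fixes A B :: "'a::monoid_add set"
  shows "0 \<in> B \<Longrightarrow> A \<subseteq> {x + y | x y. x \<in> A \<and> y \<in> B}"
    and "0 \<in> A \<Longrightarrow> B \<subseteq> {x + y | x y. x \<in> A \<and> y \<in> B}"
  by (metis (mono_tags, lifting) add.right_neutral mem_Collect_eq subsetI)
     (metis (mono_tags, lifting) add.left_neutral mem_Collect_eq subsetI)

lemma additive_subgroup_set_plus:
  fixes H K :: "'a::ab_group_add set"
  assumes "additive_subgroup H" "additive_subgroup K"
  shows "additive_subgroup {x + y | x y. x \<in> H \<and> y \<in> K}"
  unfolding additive_subgroup_def
proof (intro conjI ballI)
  show "0 \<in> {x + y | x y. x \<in> H \<and> y \<in> K}"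
    using set_plus_superset(1)[OF additive_subgroup_zero[OF assms(2)], of H]
      additive_subgroup_zero[OF assms(1)] by blast
  fix a b assume "a \<in> {x + y | x y. x \<in> H \<and> y \<in> K}" "b \<in> {x + y | x y. x \<in> H \<and> y \<in> K}"
  then obtain x y u v where "x \<in> H" "y \<in> K" "u \<in> H" "v \<in> K" "a = x + y" "b = u + v" by auto
  then have "a - b = (x - u) + (y - v)" "x - u \<in> H" "y - v \<in> K"
    using assms additive_subgroup_diff by auto
  then show "a - b \<in> {x + y | x y. x \<in> H \<and> y \<in> K}" by blast
qed

lemma finitely_generated_relatively_compact:
  fixes F :: "'a::{topological_ab_group_add,t2_space} set"
  assumes G: "lca_p_group p TYPE('a)" "prime p" and "finite F"
  shows "\<exists>S C. additive_subgroup S \<and> F \<subseteq> S \<and> S \<subseteq> C \<and> compact C"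
  using \<open>finite F\<close>
proof induction
  case empty
  show ?case by (intro exI[of _ "{0}"]) (auto simp: additive_subgroup_def)
next
  case (insert f F)
  then obtain S C where S: "additive_subgroup S" "F \<subseteq> S" "S \<subseteq> C" "compact C" by blast
  obtain D where D: "compact D" "\<And>m n. nat_mult m f - nat_mult n f \<in> D"
    using cyclic_relatively_compact[OF G] by blast
  define Z where "Z = {nat_mult m f - nat_mult n f | m n. True}"
  have Z: "additive_subgroup Z" unfolding additive_subgroup_def
  proof (intro conjI ballI)
    show "0 \<in> Z" unfolding Z_def by simp (metis diff_self)
    fix x y assume "x \<in> Z" "y \<in> Z"
    then obtain a b c d where "x = nat_mult a f - nat_mult b f" "y = nat_mult c f - nat_mult d f"
      unfolding Z_def by auto
    then have "x - y = nat_mult (a + d) f - nat_mult (b + c) f" by (simp add: nat_mult_plus)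
    then show "x - y \<in> Z" unfolding Z_def by blast
  qed
  have f: "f \<in> Z" unfolding Z_def by simp (metis diff_zero nat_mult_0 nat_mult_1)
  let ?S = "{x + y | x y. x \<in> Z \<and> y \<in> S}" and ?C = "{x + y | x y. x \<in> D \<and> y \<in> C}"
  have "additive_subgroup ?S" by (rule additive_subgroup_set_plus[OF Z S(1)])
  moreover have "insert f F \<subseteq> ?S"
    using set_plus_superset[of S Z] set_plus_superset[of Z S] f S(2)
      additive_subgroup_zero[OF S(1)] additive_subgroup_zero[OF Z] by blast
  moreover have "?S \<subseteq> ?C" using D(2) S(3) unfolding Z_def by blast
  moreover have "compact ?C" by (rule compact_set_plus[OF D(1) S(4)])
  ultimately show ?case by blast
qed

lemma open_additive_subgroupI:
  fixes H :: "'a::topological_ab_group_add set"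
  assumes "additive_subgroup H" "open A" "0 \<in> A" "A \<subseteq> H"
  shows "open H"
proof (subst open_subopen, rule ballI)
  fix x assume "x \<in> H"
  have "(\<lambda>z. z - x) -` A \<subseteq> H"
  proof
    fix z assume "z \<in> (\<lambda>z. z - x) -` A"
    then have "(z - x) + x \<in> H" using assms(1,4) \<open>x \<in> H\<close> additive_subgroup_add by blast
    then show "z \<in> H" by simp
  qed
  then show "\<exists>T. open T \<and> x \<in> T \<and> T \<subseteq> H"
    using open_translate[OF assms(2)] assms(3) by (intro exI[of _ "(\<lambda>z. z - x) -` A"]) simp
qed

lemma closed_open_subgroup:
  fixes H :: "'a::topological_ab_group_add set"
  assumes "additive_subgroup H" "open H"
  shows "closed H"
proof -
  have "- H = (\<Union>x\<in>- H. (\<lambda>z. z - x) -` H)"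
  proof (intro equalityI subsetI)
    fix x assume "x \<in> - H"
    then show "x \<in> (\<Union>x\<in>- H. (\<lambda>z. z - x) -` H)"
      using additive_subgroup_zero[OF assms(1)] by (intro UN_I[of x]) auto
  next
    fix z assume "z \<in> (\<Union>x\<in>- H. (\<lambda>z. z - x) -` H)"
    then obtain x where x: "x \<notin> H" "z - x \<in> H" by auto
    show "z \<in> - H"
    proof
      assume "z \<in> H"
      then have "z - (z - x) \<in> H" using x assms(1) additive_subgroup_diff by blast
      then show False using x by simp
    qed
  qed
  moreover have "open (\<Union>x\<in>- H. (\<lambda>z. z - x) -` H)"
    using open_translate[OF assms(2)] by blast
  ultimately show ?thesis by (simp add: closed_def)
qed

text \<open>A symmetric compact neighbourhood K satisfies \<open>K + K \<subseteq> K + F\<close> with F finite, so it becomes a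
subgroup after adding the group generated by F, which is relatively compact.\<close>

lemma compact_open_subgroup_exists:
  assumes G: "lca_p_group p TYPE('a::{topological_ab_group_add,t2_space})" "prime p"
  obtains H :: "'a::{topological_ab_group_add,t2_space} set" where "compact_open_subgroup H"
proof -
  obtain U L :: "'a::{topological_ab_group_add,t2_space} set" where U: "open U" "compact L" "0 \<in> U" "U \<subseteq> L"
    by (rule lca_p_group_compact_nbhd[OF G(1)])
  define K where "K = L \<union> uminus ` L"
  have K: "compact K" "U \<subseteq> K" "\<And>x. x \<in> K \<Longrightarrow> - x \<in> K"
    using U by (auto simp: K_def intro!: compact_Un compact_continuous_image continuous_intros)
  obtain F where F: "finite F" "F \<subseteq> {x + y | x y. x \<in> K \<and> y \<in> K}"
      "\<And>z. z \<in> {x + y | x y. x \<in> K \<and> y \<in> K} \<Longrightarrow> \<exists>x\<in>F. z - x \<in> U"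
    by (rule compact_finite_cover_translates[OF compact_set_plus[OF K(1) K(1)] U(1,3)]) blast
  obtain S C where S: "additive_subgroup S" "F \<subseteq> S" "S \<subseteq> C" "compact C"
    using finitely_generated_relatively_compact[OF G F(1)] by blast
  \<comment> \<open>Differences of elements of K lie in \<open>U + F\<close>, so the error of K as a subgroup is
    absorbed by any subgroup that contains F.\<close>
  define H where "H = {x + y | x y. x \<in> K \<and> y \<in> S}"
  have subgp: "additive_subgroup H" unfolding additive_subgroup_def
  proof (intro conjI ballI)
    show "0 \<in> H"
      using U(3) K(2) set_plus_superset(1)[OF additive_subgroup_zero[OF S(1)], of K]
      unfolding H_def by blast
    fix a b assume "a \<in> H" "b \<in> H"
    then obtain x y u v where xy: "x \<in> K" "y \<in> S" "u \<in> K" "v \<in> S" "a = x + y" "b = u + v"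
      unfolding H_def by auto
    then obtain f where f: "f \<in> F" "x + - u - f \<in> U" using F(3)[of "x + - u"] K(3) by blast
    have "a - b = (x + - u - f) + (f + (y - v))" using xy by (simp add: algebra_simps)
    moreover have "f + (y - v) \<in> S"
      using S(1,2) f xy by (intro additive_subgroup_add additive_subgroup_diff) auto
    ultimately show "a - b \<in> H" using f(2) K(2) unfolding H_def by blast
  qed
  have "U \<subseteq> H"
    using K(2) set_plus_superset(1)[OF additive_subgroup_zero[OF S(1)], of K]
    unfolding H_def by blast
  then have "open H" using open_additive_subgroupI[OF subgp U(1,3)] by simp
  have "compact ({x + y | x y. x \<in> K \<and> y \<in> C} \<inter> H)"
    by (intro compact_Int_closed compact_set_plus K S closed_open_subgroup subgp \<open>open H\<close>)
  moreover have "{x + y | x y. x \<in> K \<and> y \<in> C} \<inter> H = H"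
    using S(3) unfolding H_def by blast
  ultimately have "compact H" by simp
  with \<open>open H\<close> subgp show ?thesis using that compact_open_subgroup_iff by blast
qed

section \<open>Covering by translates of a subgroup\<close>

text \<open>For subgroups this says that the index of \<open>W \<inter> P\<close> in W is at most N. The form with
translates composes, pulls back and is compared with measures without any case distinction on
infinite indices, and the centres need not lie in W.\<close>

definition covered_by_translates :: "'a::group_add set \<Rightarrow> 'a set \<Rightarrow> nat \<Rightarrow> bool" where
  "covered_by_translates W P N \<longleftrightarrow>
     (\<exists>F. finite F \<and> card F \<le> N \<and> (\<forall>w\<in>W. \<exists>f\<in>F. w - f \<in> P))"

lemma covered_by_translates_trans:
  fixes W :: "'a::ab_group_add set"
  assumes "covered_by_translates W P N" "covered_by_translates P Q M"
  shows "covered_by_translates W Q (N * M)"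
proof -
  obtain F where F: "finite F" "card F \<le> N" "\<And>w. w \<in> W \<Longrightarrow> \<exists>f\<in>F. w - f \<in> P"
    using assms(1) by (auto simp: covered_by_translates_def)
  obtain E where E: "finite E" "card E \<le> M" "\<And>w. w \<in> P \<Longrightarrow> \<exists>f\<in>E. w - f \<in> Q"
    using assms(2) by (auto simp: covered_by_translates_def)
  let ?S = "(\<lambda>(f, e). f + e) ` (F \<times> E)"
  have "card ?S \<le> card (F \<times> E)" by (intro card_image_le) (simp add: F E)
  also have "\<dots> \<le> N * M" using F E by (simp add: card_cartesian_product mult_mono)
  finally have "card ?S \<le> N * M" .
  moreover have "\<exists>f\<in>?S. w - f \<in> Q" if w: "w \<in> W" for w
  proof -
    obtain f e where "f \<in> F" "e \<in> E" "w - f - e \<in> Q" using F(3)[OF w] E(3) by blast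
    moreover from this have "f + e \<in> ?S" by (intro image_eqI[of _ _ "(f, e)"]) auto
    ultimately show ?thesis by (intro bexI[of _ "f + e"]) (auto simp: algebra_simps)
  qed
  ultimately show ?thesis unfolding covered_by_translates_def using F(1) E(1)
    by (intro exI[of _ ?S]) auto
qed

text \<open>Division by n: two points of W with nearby multiples by n differ by an n-torsion element up to P, so
the index grows at most by the number of n-torsion elements.\<close>

lemma covered_by_translates_of_multiples:
  fixes W :: "'a::ab_group_add set"
  assumes "covered_by_translates (nat_mult n ` W) (nat_mult n ` P) N"
    and T: "finite {x::'a. nat_mult n x = 0}"
  shows "covered_by_translates W P (N * card {x::'a. nat_mult n x = 0})"
proof -
  let ?T = "{x::'a. nat_mult n x = 0}"
  obtain F where F: "finite F" "card F \<le> N"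
      "\<And>w. w \<in> W \<Longrightarrow> \<exists>f\<in>F. nat_mult n w - f \<in> nat_mult n ` P"
    using assms(1) by (auto simp: covered_by_translates_def)
  \<comment> \<open>A preimage under multiplication by n serves as new centre; the choice is arbitrary, and T
    accounts for the ambiguity.\<close>
  define g where "g f = (SOME w. nat_mult n w = f)" for f :: 'a
  let ?S = "(\<lambda>(f, t). g f + t) ` (F \<times> ?T)"
  have "card ?S \<le> card (F \<times> ?T)" by (intro card_image_le) (simp add: F T)
  also have "\<dots> \<le> N * card ?T" using F by (simp add: card_cartesian_product)
  finally have "card ?S \<le> N * card ?T" .
  moreover have "\<exists>f\<in>?S. w - f \<in> P" if w: "w \<in> W" for w
  proof -
    obtain f y where f: "f \<in> F" "y \<in> P" "nat_mult n w - f = nat_mult n y" using F(3)[OF w] by blast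
    then have "nat_mult n (w - y) = f" by (simp add: nat_mult_diff algebra_simps)
    then have "nat_mult n (g f) = f" unfolding g_def by (rule someI)
    then have "w - y - g f \<in> ?T" using f by (simp add: nat_mult_diff nat_mult_add algebra_simps)
    then have "g f + (w - y - g f) \<in> ?S" using f by (auto intro!: image_eqI[of _ _ "(f, w - y - g f)"])
    moreover have "w - (g f + (w - y - g f)) = y" by (simp add: algebra_simps)
    ultimately show ?thesis using f(2) by metis
  qed
  ultimately show ?thesis unfolding covered_by_translates_def using F(1) T
    by (intro exI[of _ ?S]) auto
qed

lemma nat_mult_image_image:
  "nat_mult m ` nat_mult n ` W = nat_mult (m * n) ` (W :: 'a::monoid_add set)"
  by (simp add: image_image nat_mult_times)

lemma covered_by_multiples_descend:
  fixes W :: "'a::ab_group_add set"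
  assumes T: "finite {x::'a. nat_mult p x = 0}"
    and "covered_by_translates (nat_mult (p ^ k) ` W) (nat_mult p ` nat_mult (p ^ k) ` W) N"
  shows "covered_by_translates W (nat_mult p ` W) (N * card {x::'a. nat_mult p x = 0} ^ k)"
  using assms(2)
proof (induction k arbitrary: W)
  case 0
  then show ?case by (simp add: image_image)
next
  case (Suc k)
  have "covered_by_translates (nat_mult p ` W) (nat_mult p ` nat_mult p ` W)
          (N * card {x::'a. nat_mult p x = 0} ^ k)"
    using Suc.prems by (intro Suc.IH) (simp add: nat_mult_image_image mult_ac)
  from covered_by_translates_of_multiples[OF this T] show ?case by (simp add: mult_ac)
qed

text \<open>The dimension argument for the vector space \<open>V / P\<close> over the field with p elements: a maximal
independent set modulo P spans, and its combinations with coefficients below p number at most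
\<open>p ^ m\<close>. The case \<open>P = {0}\<close> concerns the elements of order p, the case \<open>P = p V\<close> links the index
of \<open>p V\<close> with the rank over the p-adic integers.\<close>

lemma covered_by_translates_of_independent_bound:
  fixes V P :: "'a::ab_group_add set"
  assumes p: "prime p" and V: "additive_subgroup V" and P: "additive_subgroup P"
    and pV: "\<And>x. x \<in> V \<Longrightarrow> nat_mult p x \<in> P"
    and bound: "\<And>B. finite B \<Longrightarrow> B \<subseteq> V \<Longrightarrow>
      (\<And>c. (\<And>b. b \<in> B \<Longrightarrow> c b < p) \<Longrightarrow> (\<Sum>b\<in>B. nat_mult (c b) b) \<in> P \<Longrightarrow> \<forall>b\<in>B. c b = 0)
      \<Longrightarrow> card B \<le> m"
  shows "covered_by_translates V P (p ^ m)"
proof -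
  define indep where "indep B \<longleftrightarrow> finite B \<and> B \<subseteq> V \<and> (\<forall>c. (\<forall>b\<in>B. c b < p) \<longrightarrow>
      (\<Sum>b\<in>B. nat_mult (c b) b) \<in> P \<longrightarrow> (\<forall>b\<in>B. c b = 0))" for B
  have le_m: "card B \<le> m" if "indep B" for B
    using that by (intro bound) (auto simp: indep_def)
  have "indep {}" by (simp add: indep_def)
  moreover have "\<forall>B. indep B \<longrightarrow> card B < Suc m" using le_m by (simp add: less_Suc_eq_le)
  ultimately have "\<exists>B. indep B \<and> (\<forall>B'. indep B' \<longrightarrow> card B' \<le> card B)"
    by (rule ex_has_greatest_nat)
  then obtain B where B: "indep B" and max: "\<And>B'. indep B' \<Longrightarrow> card B' \<le> card B"
    by blast
  have finB: "finite B" and BV: "B \<subseteq> V" using B by (auto simp: indep_def)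
  have p0: "p > 0" using p prime_gt_0_nat by blast
  let ?E = "PiE B (\<lambda>_. {..<p})"
  let ?F = "(\<lambda>c. \<Sum>b\<in>B. nat_mult (c b) b) ` ?E"
  have finE: "finite ?E" using finB by (intro finite_PiE) auto
  have "card ?F \<le> card ?E" using finE by (rule card_image_le)
  also have "\<dots> = p ^ card B" using finB by (simp add: card_PiE)
  also have "\<dots> \<le> p ^ m" using le_m[OF B] p0 by (simp add: power_increasing)
  finally have card: "card ?F \<le> p ^ m" .
  have "\<exists>f\<in>?F. w - f \<in> P" if w: "w \<in> V" for w
  proof -
    have "\<exists>e. (\<forall>b\<in>B. e b < p) \<and> w - (\<Sum>b\<in>B. nat_mult (e b) b) \<in> P"
    proof (cases "w \<in> B")
      case True
      define e where "e b = (if b = w then 1 else 0::nat)" for b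
      have "(\<Sum>b\<in>B. nat_mult (e b) b) = (\<Sum>b\<in>B. if b = w then w else 0)"
        by (intro sum.cong) (auto simp: e_def)
      also have "\<dots> = w" using True finB by simp
      finally show ?thesis using additive_subgroup_zero[OF P] prime_gt_1_nat[OF p]
        by (intro exI[of _ e]) (auto simp: e_def)
    next
      case False
      \<comment> \<open>A relation that involves w by maximality of B; its coefficient at w is a unit modulo p, so it
        can be solved for w modulo P.\<close>
      have "\<not> indep (insert w B)" using max[of "insert w B"] False finB by auto
      moreover have "finite (insert w B)" "insert w B \<subseteq> V" using finB BV w by simp_all
      ultimately have "\<exists>c. (\<forall>b\<in>insert w B. c b < p) \<and>
          (\<Sum>b\<in>insert w B. nat_mult (c b) b) \<in> P \<and> \<not> (\<forall>b\<in>insert w B. c b = 0)"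
        by (simp only: indep_def simp_thms not_all not_imp)
      then obtain c where c: "\<forall>b\<in>insert w B. c b < p"
          "(\<Sum>b\<in>insert w B. nat_mult (c b) b) \<in> P" "\<not> (\<forall>b\<in>insert w B. c b = 0)"
        by (elim exE conjE)
      let ?s = "\<Sum>b\<in>B. nat_mult (c b) b"
      have s: "nat_mult (c w) w + ?s \<in> P" using c(2) False finB by simp
      have cw: "c w \<noteq> 0"
      proof
        assume "c w = 0"
        then have h1: "?s \<in> P" using s by simp
        have h2: "\<forall>b\<in>B. c b < p" using c(1) by simp
        have h3: "(\<forall>b\<in>B. c b < p) \<longrightarrow> ?s \<in> P \<longrightarrow> (\<forall>b\<in>B. c b = 0)"
          using B unfolding indep_def by (elim conjE) (erule spec)
        have "\<forall>b\<in>B. c b = 0" by (rule h3[THEN mp, OF h2, THEN mp, OF h1])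
        with c(3) \<open>c w = 0\<close> show False by (simp only: ball_simps) simp
      qed
      have "coprime (c w) p"
        using p cw c(1) by (metis coprime_commute insertI1 nat_dvd_not_less not_gr_zero prime_imp_coprime)
      then obtain d q where dq: "c w * d = p * q + 1"
        using bezout_nat[OF cw, of p] by auto
      have "nat_mult d (nat_mult (c w) w + ?s) \<in> P" using nat_mult_in_subgroup[OF P s] .
      also have "nat_mult d (nat_mult (c w) w + ?s) = nat_mult (c w * d) w + nat_mult d ?s"
        by (simp add: nat_mult_add nat_mult_times mult.commute[of "c w" d])
      also have "\<dots> = w + nat_mult d ?s + nat_mult p (nat_mult q w)"
        unfolding dq by (simp add: nat_mult_plus nat_mult_times nat_mult_Suc algebra_simps)
      finally have 1: "w + nat_mult d ?s \<in> P"
        using additive_subgroup_diff[OF P _ pV[OF nat_mult_in_subgroup[OF V w, of q]]] by fastforce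
      \<comment> \<open>The residue that represents \<open>- d * c b\<close>.\<close>
      define e where "e b = (p - (d * c b) mod p) mod p" for b
      have dvd: "p dvd e b + d * c b" for b
      proof -
        have "(e b + d * c b) mod p = (p - (d * c b) mod p + (d * c b) mod p) mod p"
          unfolding e_def by (simp add: mod_simps)
        also have "\<dots> = 0" using p0 by (simp add: less_imp_le)
        finally show ?thesis by auto
      qed
      have "(\<Sum>b\<in>B. nat_mult (e b + d * c b) b) \<in> P"
      proof (rule additive_subgroup_sum[OF P])
        fix b assume "b \<in> B"
        obtain r where "e b + d * c b = p * r" using dvd by blast
        then show "nat_mult (e b + d * c b) b \<in> P"
          using \<open>b \<in> B\<close> BV by (auto simp: nat_mult_times intro!: pV nat_mult_in_subgroup[OF V])
      qed
      also have "(\<Sum>b\<in>B. nat_mult (e b + d * c b) b) = (\<Sum>b\<in>B. nat_mult (e b) b) + nat_mult d ?s"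
        by (simp add: nat_mult_plus nat_mult_times nat_mult_sum sum.distrib)
      finally have "(w + nat_mult d ?s) - ((\<Sum>b\<in>B. nat_mult (e b) b) + nat_mult d ?s) \<in> P"
        using 1 additive_subgroup_diff[OF P] by blast
      then have "w - (\<Sum>b\<in>B. nat_mult (e b) b) \<in> P" by simp
      then show ?thesis using p0 by (intro exI[of _ e]) (auto simp: e_def)
    qed
    then obtain e where e: "\<forall>b\<in>B. e b < p" "w - (\<Sum>b\<in>B. nat_mult (e b) b) \<in> P" by blast
    have eq: "(\<Sum>b\<in>B. nat_mult (restrict e B b) b) = (\<Sum>b\<in>B. nat_mult (e b) b)"
      by (intro sum.cong) auto
    have "restrict e B \<in> ?E" using e(1) by auto
    then have "(\<Sum>b\<in>B. nat_mult (restrict e B b) b) \<in> ?F" by (rule imageI)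
    then have "(\<Sum>b\<in>B. nat_mult (e b) b) \<in> ?F" by (simp only: eq)
    then show ?thesis by (rule bexI[rotated]) (rule e(2))
  qed
  moreover have "finite ?F" using finE by (rule finite_imageI)
  ultimately show ?thesis unfolding covered_by_translates_def
    using card by (intro exI[of _ ?F] conjI ballI)
qed

lemma additive_subgroup_torsion: "additive_subgroup {x::'a::ab_group_add. nat_mult n x = 0}"
  by (auto simp: additive_subgroup_def nat_mult_diff)

lemma finite_socle:
  assumes p: "prime p" and "socle_rank p TYPE('a::ab_group_add) < \<infinity>"
  shows "finite {x::'a::ab_group_add. nat_mult p x = 0}"
proof -
  obtain m where m: "socle_rank p TYPE('a) = enat m" using assms(2) by auto
  have "covered_by_translates {x::'a. nat_mult p x = 0} {0} (p ^ m)"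
  proof (rule covered_by_translates_of_independent_bound[OF p additive_subgroup_torsion])
    show "additive_subgroup {0::'a}" by (simp add: additive_subgroup_def)
    fix B :: "'a set"
    assume "finite B" "B \<subseteq> {x. nat_mult p x = 0}"
      "\<And>c. (\<And>b. b \<in> B \<Longrightarrow> c b < p) \<Longrightarrow> (\<Sum>b\<in>B. nat_mult (c b) b) \<in> {0} \<Longrightarrow> \<forall>b\<in>B. c b = 0"
    then have "enat (card B) \<le> socle_rank p TYPE('a)"
      unfolding socle_rank_def lin_rank_def lin_indep_def by (intro SUP_upper) auto
    then show "card B \<le> m" using m by simp
  qed simp
  then obtain F where F: "finite F" "\<forall>x\<in>{x::'a. nat_mult p x = 0}. \<exists>f\<in>F. x - f \<in> {0}"
    unfolding covered_by_translates_def by blast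
  have "{x::'a. nat_mult p x = 0} \<subseteq> F"
  proof
    fix x :: 'a assume "x \<in> {x. nat_mult p x = 0}"
    then obtain f where "f \<in> F" "x - f \<in> {0}" using F(2) by blast
    then show "x \<in> F" by simp
  qed
  then show ?thesis using F(1) finite_subset by blast
qed

section \<open>The action of the p-adic integers\<close>

lemma tendsto_nat_mult:
  fixes f :: "'b \<Rightarrow> 'a::topological_monoid_add"
  shows "(f \<longlongrightarrow> a) F \<Longrightarrow> ((\<lambda>x. nat_mult n (f x)) \<longlongrightarrow> nat_mult n a) F"
  by (induction n) (auto simp: nat_mult_Suc intro!: tendsto_intros)

text \<open>Consecutive terms differ by elements of \<open>p ^ n V\<close>, a decreasing sequence of subgroups that becomes
arbitrarily small; so the sequence is Cauchy, and a cluster point in the compact set V is its limit.\<close>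

lemma padic_series_convergent:
  fixes V :: "'a::{topological_ab_group_add,t2_space} set"
  assumes G: "lca_p_group p TYPE('a)" and V: "compact V" "additive_subgroup V"
    and sV: "\<And>n. s n \<in> V" and step: "\<And>n. \<exists>v\<in>V. s (Suc n) = s n + nat_mult (p ^ n) v"
  shows "\<exists>y\<in>V. s \<longlonglongrightarrow> y"
proof -
  have diff: "\<exists>v\<in>V. s m = s n + nat_mult (p ^ n) v" if "n \<le> m" for m n
    using that
  proof (induction m rule: dec_induct)
    case base
    then show ?case using additive_subgroup_zero[OF V(2)] by (intro bexI[of _ 0]) auto
  next
    case (step m)
    then obtain v w where v: "v \<in> V" "s m = s n + nat_mult (p ^ n) v"
      and w: "w \<in> V" "s (Suc m) = s m + nat_mult (p ^ m) w" using assms(5) by blast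
    have "p ^ m = p ^ n * p ^ (m - n)" using step by (simp flip: power_add)
    then have "s (Suc m) = s n + nat_mult (p ^ n) (v + nat_mult (p ^ (m - n)) w)"
      using v w by (simp add: nat_mult_add nat_mult_times algebra_simps)
    then show ?case using v w V(2) additive_subgroup_add nat_mult_in_subgroup by blast
  qed
  obtain y where y: "y \<in> V" "inf (nhds y) (filtermap s sequentially) \<noteq> bot"
  proof -
    have "eventually (\<lambda>x. x \<in> V) (filtermap s sequentially)" using sV by (simp add: eventually_filtermap)
    moreover have "filtermap s sequentially \<noteq> bot" by (simp add: filtermap_bot_iff)
    ultimately show ?thesis using V(1)[unfolded compact_filter] that by blast
  qed
  have "s \<longlonglongrightarrow> y"
  proof (rule topological_tendstoI)
    fix N assume N: "open N" "y \<in> N"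
    have "open ((\<lambda>z. y + z) -` N)" "0 \<in> (\<lambda>z. y + z) -` N"
      using N by (auto intro!: open_vimage continuous_intros)
    then obtain A where A: "open A" "0 \<in> A" "\<And>x. x \<in> A \<Longrightarrow> - x \<in> A"
        "\<And>x z. x \<in> A \<Longrightarrow> z \<in> A \<Longrightarrow> x + z \<in> (\<lambda>z. y + z) -` N"
      using nbhd_0_add by blast
    obtain n0 where n0: "\<And>n x. n \<ge> n0 \<Longrightarrow> x \<in> V \<Longrightarrow> nat_mult (p ^ n) x \<in> A"
      using prime_powers_tendsto_uniformly[OF G V(1) A(1,2)] by blast
    have "\<exists>n\<ge>n0. s n - y \<in> A"
    proof (rule ccontr)
      assume "\<not> ?thesis"
      then have 1: "eventually (\<lambda>x. x - y \<notin> A) (filtermap s sequentially)"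
        by (auto simp: eventually_filtermap eventually_sequentially)
      have 2: "eventually (\<lambda>x. x - y \<in> A) (nhds y)"
        using eventually_nhds_in_open[OF open_translate[OF A(1), of y]] A(2) by simp
      have "eventually (\<lambda>x. False) (inf (nhds y) (filtermap s sequentially))"
        unfolding eventually_inf using 1 2 by blast
      then show False using y(2) by (simp add: trivial_limit_def)
    qed
    then obtain n where n: "n \<ge> n0" "s n - y \<in> A" by blast
    have "s m \<in> N" if mn: "m \<ge> n" for m
    proof -
      obtain v where "v \<in> V" "s m = s n + nat_mult (p ^ n) v" using diff[OF mn] by blast
      then show ?thesis using A(4)[OF n(2) n0[OF n(1)], of v] by simp
    qed
    then show "\<forall>\<^sub>F n in sequentially. s n \<in> N" unfolding eventually_sequentially by blast
  qed
  then show ?thesis using y(1) by blast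
qed

text \<open>A p-adic integer c with \<open>c \<equiv> 0\<close> modulo \<open>p ^ j\<close> is \<open>p ^ j (u + p c')\<close>, where u is its digit at
position j. This is the corresponding expansion of its action, with \<open>y = c' x\<close>. In particular the
limit that defines the action exists.\<close>

lemma padic_scale_leading_digit:
  fixes V :: "'a::{topological_ab_group_add,t2_space} set"
  assumes G: "lca_p_group p TYPE('a)" and p: "prime p" and V: "compact V" "additive_subgroup V"
    and c: "c \<in> padic_ints p" "c j = 0" and x: "x \<in> V"
  shows "\<exists>y\<in>V. padic_scale c x =
           nat_mult (p ^ j) (nat_mult (c (Suc j) div p ^ j) x + nat_mult p y)"
proof -
  have p0: "p > 0" using p prime_gt_0_nat by blast
  have cS: "c (Suc n) mod p ^ n = c n" for n using c by (auto simp: padic_ints_def)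
  \<comment> \<open>The partial sums of the digits of c above position j, shifted to the left by \<open>j + 1\<close>.\<close>
  define t where "t n = c (n + Suc j) div p ^ Suc j" for n
  have t: "c (n + Suc j) = c (Suc j) + p ^ Suc j * t n" for n
  proof -
    have "c (n + Suc j) mod p ^ Suc j = c (Suc j)"
    proof (induction n)
      case 0
      have "c (Suc j) < p ^ Suc j" using c(1) unfolding padic_ints_def by blast
      then show ?case by simp
    next
      case (Suc n)
      have "c (Suc n + Suc j) mod p ^ Suc j = c (Suc (n + Suc j)) mod p ^ (n + Suc j) mod p ^ Suc j"
        by (simp add: mod_mod_cancel le_imp_power_dvd del: power_Suc)
      also have "\<dots> = c (n + Suc j) mod p ^ Suc j" by (simp only: cS)
      also have "\<dots> = c (Suc j)" by (rule Suc)
      finally show ?case .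
    qed
    then show ?thesis unfolding t_def by (metis mod_mult_div_eq)
  qed
  define s where "s n = nat_mult (t n) x" for n
  have "\<exists>v\<in>V. s (Suc n) = s n + nat_mult (p ^ n) v" for n
  proof -
    obtain q where q: "c (Suc (n + Suc j)) = c (n + Suc j) + p ^ (n + Suc j) * q"
      using cS[of "n + Suc j"] by (metis mod_mult_div_eq)
    then have "p ^ Suc j * t (Suc n) = p ^ Suc j * (t n + p ^ n * q)"
      using t[of n] t[of "Suc n"] by (simp add: power_add algebra_simps)
    then have "t (Suc n) = t n + p ^ n * q" using p0 by simp
    then have "s (Suc n) = s n + nat_mult (p ^ n) (nat_mult q x)"
      by (simp add: s_def nat_mult_plus nat_mult_times)
    then show ?thesis using nat_mult_in_subgroup[OF V(2) x] by blast
  qed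
  moreover have "s n \<in> V" for n using nat_mult_in_subgroup[OF V(2) x] by (simp add: s_def)
  ultimately obtain y where y: "y \<in> V" "s \<longlonglongrightarrow> y"
    using padic_series_convergent[OF G V, of s] by blast
  have "c (Suc j) = p ^ j * (c (Suc j) div p ^ j)"
    using cS[of j] c(2) by (metis add.right_neutral div_mult_mod_eq mult.commute)
  then have "c (n + Suc j) = p ^ j * (c (Suc j) div p ^ j + p * t n)" for n
    using t[of n] by (simp add: algebra_simps)
  then have "nat_mult (c (n + Suc j)) x =
      nat_mult (p ^ j) (nat_mult (c (Suc j) div p ^ j) x + nat_mult p (s n))" for n
    by (simp only: s_def nat_mult_plus nat_mult_times)
  then have "(\<lambda>n. nat_mult (c (n + Suc j)) x) \<longlonglongrightarrow>
      nat_mult (p ^ j) (nat_mult (c (Suc j) div p ^ j) x + nat_mult p y)"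
    using y(2) by (simp only:) (intro tendsto_nat_mult tendsto_add tendsto_const)
  then have "(\<lambda>n. nat_mult (c n) x) \<longlonglongrightarrow>
      nat_mult (p ^ j) (nat_mult (c (Suc j) div p ^ j) x + nat_mult p y)"
    by (rule LIMSEQ_offset)
  then show ?thesis unfolding padic_scale_def using y(1) limI by blast
qed

lemma torsion_free_power:
  fixes V :: "'a::ab_group_add set"
  assumes "additive_subgroup V" "\<And>x. x \<in> V \<Longrightarrow> nat_mult p x = 0 \<Longrightarrow> x = 0"
    and "x \<in> V" "nat_mult (p ^ j) x = 0"
  shows "x = 0"
  using assms(4)
proof (induction j)
  case (Suc j)
  then have "nat_mult p (nat_mult (p ^ j) x) = 0" by (simp add: nat_mult_times)
  then show ?case using Suc.IH assms nat_mult_in_subgroup by blast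
qed (use nat_mult_1[of x] in simp)

text \<open>In a torsion-free module a nontrivial p-adic relation can be divided by the highest power of p that
divides all its coefficients; what remains is a nontrivial relation modulo \<open>p V\<close>.\<close>

lemma padic_independent_of_independent_mod_p:
  fixes V :: "'a::{topological_ab_group_add,t2_space} set"
  assumes G: "lca_p_group p TYPE('a)" and p: "prime p" and V: "compact V" "additive_subgroup V"
    and tf: "\<And>x. x \<in> V \<Longrightarrow> nat_mult p x = 0 \<Longrightarrow> x = 0"
    and B: "finite B" "B \<subseteq> V"
    and indep: "\<And>c. (\<And>b. b \<in> B \<Longrightarrow> c b < p) \<Longrightarrow>
        (\<Sum>b\<in>B. nat_mult (c b) b) \<in> nat_mult p ` V \<Longrightarrow> \<forall>b\<in>B. c b = 0"
  shows "lin_indep (padic_ints p) (\<lambda>_. 0) padic_scale B"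
  unfolding lin_indep_def
proof (intro conjI allI impI)
  fix c
  assume c: "\<forall>b\<in>B. c b \<in> padic_ints p" and s0: "(\<Sum>b\<in>B. padic_scale (c b) b) = 0"
  have p0: "p > 0" using p prime_gt_0_nat by blast
  show "\<forall>b\<in>B. c b = (\<lambda>_. 0)"
  proof (rule ccontr)
    assume "\<not> ?thesis"
    then have ex: "\<exists>i. \<exists>b\<in>B. c b i \<noteq> 0" by auto
    \<comment> \<open>All coefficients vanish modulo \<open>p ^ (i - 1)\<close>, and dividing by this power leaves a
      relation that is nontrivial modulo p.\<close>
    define i where "i = (LEAST i. \<exists>b\<in>B. c b i \<noteq> 0)"
    have i: "\<exists>b\<in>B. c b i \<noteq> 0" unfolding i_def by (rule LeastI_ex) (rule ex)
    have "c b 0 = 0" if "b \<in> B" for b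
    proof -
      have "c b 0 < p ^ 0" using c that unfolding padic_ints_def by blast
      then show ?thesis by simp
    qed
    with i have "i \<noteq> 0" by metis
    then obtain j where j: "i = Suc j" using not0_implies_Suc by blast
    have cj: "c b j = 0" if "b \<in> B" for b
      using not_less_Least[of j "\<lambda>i. \<exists>b\<in>B. c b i \<noteq> 0"] j that unfolding i_def by auto
    define u where "u b = c b (Suc j) div p ^ j" for b
    have "\<forall>b\<in>B. \<exists>y\<in>V. padic_scale (c b) b = nat_mult (p ^ j) (nat_mult (u b) b + nat_mult p y)"
      unfolding u_def using padic_scale_leading_digit[OF G p V] c cj B(2) by blast
    then obtain y where y: "\<And>b. b \<in> B \<Longrightarrow> y b \<in> V"
      "\<And>b. b \<in> B \<Longrightarrow> padic_scale (c b) b = nat_mult (p ^ j) (nat_mult (u b) b + nat_mult p (y b))"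
      by metis
    let ?z = "(\<Sum>b\<in>B. nat_mult (u b) b) + nat_mult p (\<Sum>b\<in>B. y b)"
    have "(\<Sum>b\<in>B. padic_scale (c b) b) = (\<Sum>b\<in>B. nat_mult (p ^ j) (nat_mult (u b) b + nat_mult p (y b)))"
      using y(2) by (intro sum.cong) auto
    also have "\<dots> = nat_mult (p ^ j) ?z"
      by (simp add: nat_mult_sum sum.distrib nat_mult_add)
    finally have z0: "nat_mult (p ^ j) ?z = 0" using s0 by simp
    have yV: "(\<Sum>b\<in>B. y b) \<in> V" using y(1) by (rule additive_subgroup_sum[OF V(2)])
    have "(\<Sum>b\<in>B. nat_mult (u b) b) \<in> V"
      using B(2) by (intro additive_subgroup_sum[OF V(2)] nat_mult_in_subgroup[OF V(2)]) auto
    then have "?z \<in> V"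
      using yV V(2) by (intro additive_subgroup_add nat_mult_in_subgroup)
    then have "?z = 0" using torsion_free_power[OF V(2) tf _ z0] by blast
    then have "(\<Sum>b\<in>B. nat_mult (u b) b) = nat_mult p (- (\<Sum>b\<in>B. y b))"
      by (simp add: nat_mult_minus eq_neg_iff_add_eq_0)
    then have "(\<Sum>b\<in>B. nat_mult (u b) b) \<in> nat_mult p ` V"
      using additive_subgroup_minus[OF V(2) yV] by blast
    moreover have "u b < p" if "b \<in> B" for b
    proof -
      have "c b (Suc j) < p ^ Suc j" using c that unfolding padic_ints_def by blast
      then show ?thesis unfolding u_def using p0 by (simp add: less_mult_imp_div_less)
    qed
    ultimately have u0: "\<forall>b\<in>B. u b = 0" using indep by blast
    have "c b (Suc j) = 0" if "b \<in> B" for b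
    proof -
      have "c b (Suc j) mod p ^ j = c b j" using c that unfolding padic_ints_def by blast
      then have "c b (Suc j) mod p ^ j = 0" using cj that by simp
      moreover have "c b (Suc j) div p ^ j = 0" using u0 that by (simp add: u_def)
      ultimately show ?thesis by (metis div_mult_mod_eq mult_zero_left add_0)
    qed
    moreover obtain b where "b \<in> B" "c b (Suc j) \<noteq> 0" using i[unfolded j] by (rule bexE)
    ultimately show False by simp
  qed
qed (rule B(1))

section \<open>Uniform bound on the index of the multiples\<close>

lemma covered_by_multiples_of_torsion_free:
  fixes V :: "'a::{topological_ab_group_add,t2_space} set"
  assumes G: "lca_p_group p TYPE('a)" and p: "prime p" and V: "compact V" "additive_subgroup V"
    and tf: "\<And>x. x \<in> V \<Longrightarrow> nat_mult p x = 0 \<Longrightarrow> x = 0"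
    and m: "Zp_rank p TYPE('a) = enat m"
  shows "covered_by_translates V (nat_mult p ` V) (p ^ m)"
proof (rule covered_by_translates_of_independent_bound[OF p V(2) additive_subgroup_nat_mult[OF V(2)]])
  fix B
  assume B: "finite B" "B \<subseteq> V" "\<And>c. (\<And>b. b \<in> B \<Longrightarrow> c b < p) \<Longrightarrow>
        (\<Sum>b\<in>B. nat_mult (c b) b) \<in> nat_mult p ` V \<Longrightarrow> \<forall>b\<in>B. c b = 0"
  have "enat (card B) \<le> Zp_rank p TYPE('a)"
    unfolding Zp_rank_def lin_rank_def
    using padic_independent_of_independent_mod_p[OF G p V tf B] by (intro SUP_upper) auto
  then show "card B \<le> m" using m by simp
qed auto

text \<open>Here both ranks enter. If \<open>p ^ k V\<close> is torsion-free, the index of \<open>p W\<close> in W is controlled by the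
p-adic rank for \<open>p ^ k W\<close> in place of W, and the finitely many elements of order p give the
remaining factor on the way down from \<open>p ^ k W\<close> to W. Neither k nor the bound depends on W, which
makes the bound the same for all cotrajectories of one subgroup.\<close>

lemma covered_by_multiples_uniform:
  fixes V :: "'a::{topological_ab_group_add,t2_space} set"
  assumes G: "lca_p_group p TYPE('a)" and p: "prime p" and V: "compact V"
    and rank: "rank_p p TYPE('a) < \<infinity>"
  obtains C where "\<And>W. W \<subseteq> V \<Longrightarrow> compact W \<Longrightarrow> additive_subgroup W \<Longrightarrow>
    covered_by_translates W (nat_mult p ` W) C"
proof -
  obtain m where m: "Zp_rank p TYPE('a) = enat m"
    using rank by (cases "Zp_rank p TYPE('a)") (auto simp: rank_p_def)
  have "socle_rank p TYPE('a) < \<infinity>"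
    using rank by (cases "socle_rank p TYPE('a)") (auto simp: rank_p_def)
  then have T: "finite {x::'a. nat_mult p x = 0}" by (rule finite_socle[OF p])
  \<comment> \<open>A neighbourhood of 0 that excludes the finitely many nonzero elements of order p, so that
    \<open>p ^ k V\<close> is torsion-free once it lies in N.\<close>
  define N where "N = - ({x::'a. nat_mult p x = 0} - {0})"
  have "open N" unfolding N_def using T by (intro open_Compl finite_imp_closed) auto
  moreover have "0 \<in> N" by (simp add: N_def)
  ultimately obtain k where k: "\<And>x. x \<in> V \<Longrightarrow> nat_mult (p ^ k) x \<in> N"
    using prime_powers_tendsto_uniformly[OF G V] by blast
  show ?thesis
  proof (rule that)
    fix W assume W: "W \<subseteq> V" "compact W" "additive_subgroup W"
    have "covered_by_translates (nat_mult (p ^ k) ` W) (nat_mult p ` nat_mult (p ^ k) ` W) (p ^ m)"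
    proof (rule covered_by_multiples_of_torsion_free[OF G p _ _ _ m])
      fix x assume "x \<in> nat_mult (p ^ k) ` W" "nat_mult p x = 0"
      then show "x = 0" using k W(1) unfolding N_def by blast
    qed (intro compact_nat_mult additive_subgroup_nat_mult W)+
    then show "covered_by_translates W (nat_mult p ` W) (p ^ m * card {x::'a. nat_mult p x = 0} ^ k)"
      by (rule covered_by_multiples_descend[OF T])
  qed
qed

lemma covered_by_prime_power_multiples:
  fixes V :: "'a::{topological_ab_group_add,t2_space} set"
  assumes C: "\<And>W. W \<subseteq> V \<Longrightarrow> compact W \<Longrightarrow> additive_subgroup W \<Longrightarrow>
    covered_by_translates W (nat_mult p ` W) C"
    and W: "W \<subseteq> V" "compact W" "additive_subgroup W"
  shows "covered_by_translates W (nat_mult (p ^ k) ` W) (C ^ k)"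
proof (induction k)
  case 0
  have "covered_by_translates W W 1" unfolding covered_by_translates_def
    by (intro exI[of _ "{0}"]) auto
  then show ?case by (simp add: image_def)
next
  case (Suc k)
  have "nat_mult (p ^ k) ` W \<subseteq> V"
    using nat_mult_in_subgroup[OF W(3)] W(1) by blast
  then have "covered_by_translates (nat_mult (p ^ k) ` W) (nat_mult p ` nat_mult (p ^ k) ` W) C"
    by (intro C compact_nat_mult W additive_subgroup_nat_mult)
  from covered_by_translates_trans[OF Suc this] show ?case
    by (simp add: nat_mult_image_image mult_ac)
qed

section \<open>Haar measure and indices\<close>

lemma left_haar_measure_sets:
  assumes "left_haar_measure \<mu>"
  shows "sets \<mu> = sets borel" "space \<mu> = UNIV"
proof -
  show "sets \<mu> = sets borel" using assms by (simp add: left_haar_measure_def)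
  then show "space \<mu> = UNIV" using sets_eq_imp_space_eq[of \<mu> borel] by simp
qed

lemma left_haar_measure_compact:
  "left_haar_measure \<mu> \<Longrightarrow> compact K \<Longrightarrow> emeasure \<mu> K < \<infinity>"
  by (simp add: left_haar_measure_def)

lemma translate_image_eq:
  fixes P :: "'a::ab_group_add set"
  shows "(\<lambda>y. f + y) ` P = (\<lambda>z. z - f) -` P"
proof (intro equalityI subsetI)
  fix z assume "z \<in> (\<lambda>z. z - f) -` P"
  then show "z \<in> (\<lambda>y. f + y) ` P" by (intro image_eqI[of _ _ "z - f"]) auto
qed auto

lemma left_haar_measure_translate:
  fixes \<mu> :: "'a::{topological_ab_group_add,t2_space} measure"
  assumes "left_haar_measure \<mu>" "A \<in> sets borel"
  shows "emeasure \<mu> ((\<lambda>y. x + y) ` A) = emeasure \<mu> A" "(\<lambda>y. x + y) ` A \<in> sets \<mu>"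
proof -
  show "emeasure \<mu> ((\<lambda>y. x + y) ` A) = emeasure \<mu> A"
    using assms by (simp add: left_haar_measure_def)
  have "(\<lambda>z. z - x) \<in> borel_measurable borel"
    by (intro borel_measurable_continuous_onI continuous_intros)
  from measurable_sets[OF this assms(2)] have "(\<lambda>z. z - x) -` A \<in> sets borel" by simp
  then show "(\<lambda>y. x + y) ` A \<in> sets \<mu>"
    unfolding translate_image_eq left_haar_measure_sets[OF assms(1)] .
qed

lemma left_haar_measure_covered:
  fixes \<mu> :: "'a::{topological_ab_group_add,t2_space} measure"
  assumes \<mu>: "left_haar_measure \<mu>" and P: "P \<in> sets borel" and "covered_by_translates W P N"
  shows "emeasure \<mu> W \<le> of_nat N * emeasure \<mu> P"
proof -
  obtain F where F: "finite F" "card F \<le> N" "\<And>w. w \<in> W \<Longrightarrow> \<exists>f\<in>F. w - f \<in> P"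
    using assms(3) unfolding covered_by_translates_def by blast
  have meas: "(\<lambda>f. (\<lambda>y. f + y) ` P) ` F \<subseteq> sets \<mu>"
    using left_haar_measure_translate(2)[OF \<mu> P] by blast
  have "W \<subseteq> (\<Union>f\<in>F. (\<lambda>y. f + y) ` P)" using F(3) unfolding translate_image_eq by blast
  moreover have "(\<Union>f\<in>F. (\<lambda>y. f + y) ` P) \<in> sets \<mu>"
    using meas F(1) by (intro sets.finite_UN) auto
  ultimately have "emeasure \<mu> W \<le> emeasure \<mu> (\<Union>f\<in>F. (\<lambda>y. f + y) ` P)" by (rule emeasure_mono)
  also have "\<dots> \<le> (\<Sum>f\<in>F. emeasure \<mu> ((\<lambda>y. f + y) ` P))"
    by (rule emeasure_subadditive_finite[OF F(1) meas])
  also have "\<dots> = of_nat (card F) * emeasure \<mu> P"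
    by (simp add: left_haar_measure_translate(1)[OF \<mu> P])
  also have "\<dots> \<le> of_nat N * emeasure \<mu> P"
    using F(2) by (intro mult_right_mono) auto
  finally show ?thesis .
qed

text \<open>Otherwise all compact sets, being covered by finitely many translates of V, would be null, and by
inner regularity so would the whole group.\<close>

lemma left_haar_measure_open_pos:
  fixes \<mu> :: "'a::{topological_ab_group_add,t2_space} measure"
  assumes \<mu>: "left_haar_measure \<mu>" and V: "open V" "0 \<in> V"
  shows "emeasure \<mu> V > 0"
proof (rule ccontr)
  assume "\<not> ?thesis"
  then have V0: "emeasure \<mu> V = 0" by simp
  have "emeasure \<mu> K \<le> 0" if K: "compact K" for K
  proof -
    obtain X where X: "finite X" "X \<subseteq> K" "\<And>z. z \<in> K \<Longrightarrow> \<exists>x\<in>X. z - x \<in> V"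
      by (rule compact_finite_cover_translates[OF K V]) blast
    have "covered_by_translates K V (card X)"
      unfolding covered_by_translates_def using X by (intro exI[of _ X]) simp
    from left_haar_measure_covered[OF \<mu> _ this] show ?thesis using V V0 by simp
  qed
  then have "(SUP K\<in>{K. compact K \<and> K \<subseteq> UNIV}. emeasure \<mu> K) \<le> 0" by (intro SUP_least) simp
  moreover have "emeasure \<mu> UNIV = (SUP K\<in>{K. compact K \<and> K \<subseteq> UNIV}. emeasure \<mu> K)"
    using \<mu> unfolding left_haar_measure_def by (elim conjE) simp
  ultimately have "emeasure \<mu> (space \<mu>) = 0" using left_haar_measure_sets(2)[OF \<mu>] by simp
  then show False using \<mu> by (simp add: left_haar_measure_def)
qed

lemma left_haar_measure_separated:
  fixes \<mu> :: "'a::{topological_ab_group_add,t2_space} measure"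
  assumes \<mu>: "left_haar_measure \<mu>" and P: "P \<in> sets borel" "additive_subgroup P"
    and W: "W \<in> sets borel" "additive_subgroup W" "P \<subseteq> W"
    and S: "finite S" "S \<subseteq> W" "\<And>s t. s \<in> S \<Longrightarrow> t \<in> S \<Longrightarrow> s \<noteq> t \<Longrightarrow> s - t \<notin> P"
  shows "of_nat (card S) * emeasure \<mu> P \<le> emeasure \<mu> W"
proof -
  have meas: "(\<lambda>f. (\<lambda>y. f + y) ` P) ` S \<subseteq> sets \<mu>"
    using left_haar_measure_translate(2)[OF \<mu> P(1)] by blast
  have "disjoint_family_on (\<lambda>f. (\<lambda>y. f + y) ` P) S"
    unfolding disjoint_family_on_def translate_image_eq
  proof (intro ballI impI equals0I)
    fix s t z assume st: "s \<in> S" "t \<in> S" "s \<noteq> t" and z: "z \<in> (\<lambda>z. z - s) -` P \<inter> (\<lambda>z. z - t) -` P"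
    then have "(z - t) - (z - s) \<in> P" using additive_subgroup_diff[OF P(2)] by blast
    then show False using S(3)[OF st] by simp
  qed
  then have "(\<Sum>f\<in>S. emeasure \<mu> ((\<lambda>y. f + y) ` P)) = emeasure \<mu> (\<Union>f\<in>S. (\<lambda>y. f + y) ` P)"
    by (rule sum_emeasure[OF meas _ S(1)])
  also have "\<dots> \<le> emeasure \<mu> W"
  proof (rule emeasure_mono)
    show "(\<Union>f\<in>S. (\<lambda>y. f + y) ` P) \<subseteq> W"
      using S(2) W(3) additive_subgroup_add[OF W(2)] by blast
  qed (simp add: W left_haar_measure_sets[OF \<mu>])
  finally show ?thesis by (simp add: left_haar_measure_translate(1)[OF \<mu> P(1)])
qed

section \<open>Endomorphisms, scale and cotrajectories\<close>

lemma hom_diff: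
  fixes \<phi> :: "'a::group_add \<Rightarrow> 'b::group_add"
  assumes "\<And>x y. \<phi> (x + y) = \<phi> x + \<phi> y"
  shows "\<phi> (x - y) = \<phi> x - \<phi> y"
  using assms[of "x - y" y] by (simp add: eq_diff_eq)

lemma hom_zero:
  fixes \<phi> :: "'a::group_add \<Rightarrow> 'b::group_add"
  assumes "\<And>x y. \<phi> (x + y) = \<phi> x + \<phi> y"
  shows "\<phi> 0 = 0"
  using hom_diff[OF assms, of 0 0] by simp

lemma hom_funpow:
  fixes \<phi> :: "'a::group_add \<Rightarrow> 'a"
  assumes "\<And>x y. \<phi> (x + y) = \<phi> x + \<phi> y"
  shows "(\<phi> ^^ n) (x + y) = (\<phi> ^^ n) x + (\<phi> ^^ n) y"
  by (induction n) (simp_all add: assms)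

lemma additive_subgroup_vimage:
  fixes \<phi> :: "'a::group_add \<Rightarrow> 'b::group_add"
  assumes "\<And>x y. \<phi> (x + y) = \<phi> x + \<phi> y" "additive_subgroup U"
  shows "additive_subgroup (\<phi> -` U)"
  using assms(2) by (simp add: additive_subgroup_def hom_diff[OF assms(1)] hom_zero[OF assms(1)])

lemma additive_subgroup_Int:
  "additive_subgroup U \<Longrightarrow> additive_subgroup V \<Longrightarrow> additive_subgroup (U \<inter> V)"
  by (simp add: additive_subgroup_def)

lemma cont_endomorphismsD:
  assumes "\<phi> \<in> cont_endomorphisms"
  shows "\<phi> (x + y) = \<phi> x + \<phi> y" "continuous_on UNIV \<phi>" "continuous_on UNIV (\<phi> ^^ n)"
proof -
  show c: "continuous_on UNIV \<phi>" and "\<phi> (x + y) = \<phi> x + \<phi> y"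
    using assms by (simp_all add: cont_endomorphisms_def)
  show "continuous_on UNIV (\<phi> ^^ n)"
  proof (induction n)
    case (Suc n)
    then show ?case using continuous_on_compose2[OF c Suc] by (simp add: comp_def)
  qed (simp add: id_def)
qed

lemma compact_open_subgroup_Int_vimage:
  fixes \<phi> :: "'a::{topological_ab_group_add,t2_space} \<Rightarrow> 'a"
  assumes \<phi>: "\<phi> \<in> cont_endomorphisms" and U: "compact_open_subgroup U" "compact_open_subgroup V"
  shows "compact_open_subgroup (U \<inter> \<phi> -` V)"
proof -
  note \<phi> = cont_endomorphismsD[OF \<phi>]
  have U: "compact U" "open U" "additive_subgroup U" and V: "compact V" "open V" "additive_subgroup V"
    using U by (simp_all add: compact_open_subgroup_iff)
  have "compact (U \<inter> \<phi> -` V)"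
    by (intro compact_Int_closed U closed_vimage compact_imp_closed V \<phi>)
  moreover have "open (U \<inter> \<phi> -` V)"
    by (intro open_Int U open_vimage V \<phi>)
  moreover have "additive_subgroup (U \<inter> \<phi> -` V)"
    by (intro additive_subgroup_Int U additive_subgroup_vimage V \<phi>)
  ultimately show ?thesis by (simp add: compact_open_subgroup_iff)
qed

text \<open>The map \<open>\<phi>\<close> turns the index in the definition of the scale into the index of
\<open>U \<inter> \<phi>\<^sup>-\<^sup>1 U\<close> in U. It is finite because U is compact and the subgroup is open. The
representatives serve both directions: they give a covering of U, and they are separated.\<close>

lemma subgroup_index_representatives:
  fixes \<phi> :: "'a::{topological_ab_group_add,t2_space} \<Rightarrow> 'a"
  assumes \<phi>: "\<phi> \<in> cont_endomorphisms" and U: "compact_open_subgroup U"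
  obtains S where "finite S" "S \<subseteq> U" "card S = subgroup_index (\<phi> ` U) (U \<inter> \<phi> ` U)"
    "\<And>u. u \<in> U \<Longrightarrow> \<exists>s\<in>S. u - s \<in> U \<inter> \<phi> -` U"
    "\<And>s t. s \<in> S \<Longrightarrow> t \<in> S \<Longrightarrow> s \<noteq> t \<Longrightarrow> s - t \<notin> U \<inter> \<phi> -` U"
proof -
  have add: "\<phi> (x + y) = \<phi> x + \<phi> y" for x y using cont_endomorphismsD[OF \<phi>] by blast
  let ?P = "U \<inter> \<phi> -` U" and ?Q = "U \<inter> \<phi> ` U"
  have Us: "compact U" "additive_subgroup U" using U by (simp_all add: compact_open_subgroup_iff)
  have P: "open ?P" "additive_subgroup ?P"
    using compact_open_subgroup_Int_vimage[OF \<phi> U U] by (simp_all add: compact_open_subgroup_iff)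
  define g where "g u = (\<lambda>y. \<phi> u + y) ` ?Q" for u
  \<comment> \<open>The cosets of \<open>U \<inter> \<phi> U\<close> in \<open>\<phi> U\<close> correspond to those of \<open>U \<inter> \<phi>\<^sup>-\<^sup>1 U\<close> in U.\<close>
  have g: "g u = g v \<longleftrightarrow> u - v \<in> ?P" if u: "u \<in> U" and v: "v \<in> U" for u v
  proof
    have "0 \<in> ?Q" using additive_subgroup_zero[OF Us(2)] hom_zero[OF add] by (metis IntI image_eqI)
    then have "\<phi> u + 0 \<in> g u" unfolding g_def by (rule imageI)
    moreover assume "g u = g v"
    ultimately obtain q where "q \<in> ?Q" "\<phi> u + 0 = \<phi> v + q" unfolding g_def by (metis imageE)
    then have "\<phi> (u - v) \<in> U" by (simp add: hom_diff[OF add])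
    then show "u - v \<in> ?P" using additive_subgroup_diff[OF Us(2) u v] by simp
  next
    have sub: "g a \<subseteq> g b" if ab: "a - b \<in> ?P" for a b
    proof
      fix z assume "z \<in> g a"
      then obtain x where x: "x \<in> U" "\<phi> x \<in> U" "z = \<phi> a + \<phi> x" unfolding g_def by auto
      have "\<phi> (a - b + x) \<in> U" using ab x add additive_subgroup_add[OF Us(2)] by simp
      moreover have "a - b + x \<in> U" using ab x additive_subgroup_add[OF Us(2)] by simp
      ultimately have "\<phi> (a - b + x) \<in> ?Q" by blast
      then have "\<phi> b + \<phi> (a - b + x) \<in> g b" unfolding g_def by (rule imageI)
      then show "z \<in> g b" using x by (simp add: add hom_diff[OF add])
    qed
    assume "u - v \<in> ?P"
    moreover from this have "v - u \<in> ?P" using additive_subgroup_minus[OF P(2)] by fastforce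
    ultimately show "g u = g v" using sub by blast
  qed
  have "0 \<in> ?P" using P(2) by (rule additive_subgroup_zero)
  then obtain X where X: "finite X" "X \<subseteq> U" "\<And>z. z \<in> U \<Longrightarrow> \<exists>x\<in>X. z - x \<in> ?P"
    using compact_finite_cover_translates[OF Us(1) P(1)] by metis
  have "g ` U \<subseteq> g ` X"
  proof
    fix y assume "y \<in> g ` U"
    then obtain u where u: "u \<in> U" "y = g u" by blast
    then obtain x where x: "x \<in> X" "u - x \<in> ?P" using X(3) by blast
    then have "g u = g x" using g[OF u(1), of x] X(2) by blast
    then show "y \<in> g ` X" using u x by simp
  qed
  then have fin: "finite (g ` U)" using X(1) finite_subset by blast
  have "\<exists>S. S \<subseteq> U \<and> inj_on g S \<and> g ` U = g ` S"
    by (rule subset_image_inj[THEN iffD1, OF subset_refl])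
  then obtain S where S: "S \<subseteq> U" "inj_on g S" "g ` U = g ` S" by (elim exE conjE)
  show ?thesis
  proof (rule that[of S])
    show "finite S" using fin S(2) unfolding S(3) by (rule finite_imageD)
    show "S \<subseteq> U" by (rule S)
    have "subgroup_index (\<phi> ` U) ?Q = card (g ` U)"
      unfolding subgroup_index_def g_def by (simp add: image_image)
    also have "\<dots> = card S" unfolding S(3) by (rule card_image[OF S(2)])
    finally show "card S = subgroup_index (\<phi> ` U) ?Q" by simp
    show "\<exists>s\<in>S. u - s \<in> ?P" if u: "u \<in> U" for u
    proof -
      have "g u \<in> g ` S" using u S(3) by blast
      then obtain s where s: "s \<in> S" "g u = g s" by blast
      then show ?thesis using g[OF u, of s] S(1) by blast
    qed
    show "s - t \<notin> ?P" if st: "s \<in> S" "t \<in> S" "s \<noteq> t" for s t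
    proof -
      have "g s \<noteq> g t" using inj_on_eq_iff[OF S(2) st(1,2)] st(3) by simp
      then show ?thesis using g[OF subsetD[OF S(1) st(1)] subsetD[OF S(1) st(2)]] by simp
    qed
  qed
qed

lemma endo_scale_le:
  "compact_open_subgroup U \<Longrightarrow> endo_scale \<phi> \<le> subgroup_index (\<phi> ` U) (U \<inter> \<phi> ` U)"
  unfolding endo_scale_def by (intro cInf_lower) auto

lemma endo_scale_attained:
  fixes \<phi> :: "'a::topological_group_add \<Rightarrow> 'a" and U :: "'a set"
  assumes "compact_open_subgroup U"
  obtains V where "compact_open_subgroup V" "endo_scale \<phi> = subgroup_index (\<phi> ` V) (V \<inter> \<phi> ` V)"
proof -
  let ?I = "{subgroup_index (\<phi> ` U) (U \<inter> \<phi> ` U) | U. compact_open_subgroup U}"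
  have "subgroup_index (\<phi> ` U) (U \<inter> \<phi> ` U) \<in> ?I"
    using assms by blast
  then have "?I \<noteq> {}" by (intro notI) (simp only: empty_iff)
  then have "endo_scale \<phi> \<in> ?I" unfolding endo_scale_def by (rule Inf_nat_def1)
  then show ?thesis by (elim CollectE exE conjE) (rule that)
qed

lemma cotrajectory_Suc: "cotrajectory \<phi> U (Suc n) = cotrajectory \<phi> U n \<inter> (\<phi> ^^ n) -` U"
  by (auto simp: cotrajectory_def less_Suc_eq)

lemma cotrajectory_1: "cotrajectory \<phi> U (Suc 0) = U"
  by (auto simp: cotrajectory_def)

text \<open>Passing from one cotrajectory C to the next is the step from C to \<open>C \<inter> \<phi>\<^sup>-\<^sup>1 C\<close>, the very
step whose index the scale minimizes.\<close>

lemma cotrajectory_Suc_Suc: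
  "cotrajectory \<phi> U (Suc (Suc n)) = cotrajectory \<phi> U (Suc n) \<inter> \<phi> -` cotrajectory \<phi> U (Suc n)"
proof (induction n)
  case 0
  then show ?case by (auto simp: cotrajectory_def less_Suc_eq)
next
  case (Suc n)
  have "(\<phi> ^^ Suc (Suc n)) -` U = \<phi> -` (\<phi> ^^ Suc n) -` U"
    by (simp add: vimage_comp funpow_Suc_right del: funpow.simps)
  with Suc show ?case unfolding cotrajectory_Suc[of \<phi> U "Suc (Suc n)"] cotrajectory_Suc[of \<phi> U "Suc n"]
    by blast
qed

lemma compact_open_subgroup_cotrajectory:
  fixes \<phi> :: "'a::{topological_ab_group_add,t2_space} \<Rightarrow> 'a"
  assumes "\<phi> \<in> cont_endomorphisms" "compact_open_subgroup U"
  shows "compact_open_subgroup (cotrajectory \<phi> U (Suc n))"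
proof (induction n)
  case (Suc n)
  then show ?case
    unfolding cotrajectory_Suc_Suc by (intro compact_open_subgroup_Int_vimage assms)
qed (simp add: cotrajectory_1 assms)

lemma compact_open_subgroup_measure:
  fixes \<mu> :: "'a::{topological_ab_group_add,t2_space} measure"
  assumes \<mu>: "left_haar_measure \<mu>" and U: "compact_open_subgroup U"
  shows "emeasure \<mu> U = ennreal (measure \<mu> U)" "measure \<mu> U > 0" "U \<in> sets borel"
proof -
  have U: "compact U" "open U" "0 \<in> U" using U by (simp_all add: compact_open_subgroup_def)
  show "U \<in> sets borel" using U by simp
  have "emeasure \<mu> U < \<infinity>" using left_haar_measure_compact[OF \<mu> U(1)] .
  then show 1: "emeasure \<mu> U = ennreal (measure \<mu> U)" by (simp add: emeasure_eq_ennreal_measure)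
  show "measure \<mu> U > 0" using left_haar_measure_open_pos[OF \<mu> U(2,3)] unfolding 1
    by (simp add: ennreal_less_zero_iff)
qed

lemma covered_by_translates_vimage:
  fixes \<psi> :: "'a::ab_group_add \<Rightarrow> 'b::ab_group_add"
  assumes add: "\<And>x y. \<psi> (x + y) = \<psi> x + \<psi> y" and cov: "covered_by_translates V P N"
    and P: "additive_subgroup P" and W: "additive_subgroup W" "W \<subseteq> \<psi> -` V"
  shows "covered_by_translates W (W \<inter> \<psi> -` P) N"
proof -
  obtain F where F: "finite F" "card F \<le> N" "\<And>v. v \<in> V \<Longrightarrow> \<exists>f\<in>F. v - f \<in> P"
    using cov unfolding covered_by_translates_def by blast
  define g where "g f = (SOME w. w \<in> W \<and> \<psi> w - f \<in> P)" for f
  have "\<exists>s\<in>g ` F. w - s \<in> W \<inter> \<psi> -` P" if w: "w \<in> W" for w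
  proof -
    obtain f where f: "f \<in> F" "\<psi> w - f \<in> P" using F(3) W(2) w by blast
    have "g f \<in> W \<and> \<psi> (g f) - f \<in> P"
      unfolding g_def by (rule someI[of _ w]) (use w f in simp)
    then have "w - g f \<in> W" "(\<psi> w - f) - (\<psi> (g f) - f) \<in> P"
      using w f additive_subgroup_diff W(1) P by blast+
    then show ?thesis using f(1) by (intro bexI[of _ "g f"]) (simp_all add: hom_diff[OF add])
  qed
  moreover have "card (g ` F) \<le> N" using card_image_le[OF F(1)] F(2) by (rule order_trans)
  ultimately show ?thesis unfolding covered_by_translates_def using F(1)
    by (intro exI[of _ "g ` F"]) simp
qed

section \<open>Entropy and scale\<close>

lemma limsup_quotient_bounds:
  fixes x :: "nat \<Rightarrow> real"
  shows "(\<And>n. real n * L - c \<le> x (Suc n)) \<Longrightarrow> ereal L \<le> limsup (\<lambda>n. ereal (x n / real n))"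
    and "(\<And>n. x (Suc n) \<le> real n * L - c) \<Longrightarrow> limsup (\<lambda>n. ereal (x n / real n)) \<le> ereal L"
proof -
  have "(\<lambda>n. L - (L + c) / real n) \<longlonglongrightarrow> L - 0"
    by (intro tendsto_diff tendsto_const lim_const_over_n)
  then have "(\<lambda>n. ereal (L - (L + c) / real n)) \<longlonglongrightarrow> ereal L" by simp
  then have lim: "limsup (\<lambda>n. ereal (L - (L + c) / real n)) = ereal L"
    by (intro lim_imp_Limsup) simp_all
  \<comment> \<open>For index \<open>n + 1\<close> the bound \<open>(n L - c) / (n + 1)\<close> equals
    \<open>L - (L + c) / (n + 1)\<close>.\<close>
  have eq: "L - (L + c) / real (Suc n) = (real n * L - c) / real (Suc n)" for n
    by (simp add: field_simps)
  show "ereal L \<le> limsup (\<lambda>n. ereal (x n / real n))" if "\<And>n. real n * L - c \<le> x (Suc n)"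
    unfolding lim[symmetric]
  proof (intro Limsup_mono eventually_mono[OF eventually_gt_at_top[of 0]])
    fix n :: nat assume "0 < n"
    then obtain k where "n = Suc k" using gr0_implies_Suc by blast
    then show "ereal (L - (L + c) / real n) \<le> ereal (x n / real n)"
      using eq[of k] that[of k] by (simp del: of_nat_Suc add: divide_right_mono)
  qed
  show "limsup (\<lambda>n. ereal (x n / real n)) \<le> ereal L" if "\<And>n. x (Suc n) \<le> real n * L - c"
    unfolding lim[symmetric]
  proof (intro Limsup_mono eventually_mono[OF eventually_gt_at_top[of 0]])
    fix n :: nat assume "0 < n"
    then obtain k where "n = Suc k" using gr0_implies_Suc by blast
    then show "ereal (x n / real n) \<le> ereal (L - (L + c) / real n)"
      using eq[of k] that[of k] by (simp del: of_nat_Suc add: divide_right_mono)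
  qed
qed

lemma endo_scale_pos:
  fixes \<phi> :: "'a::{topological_ab_group_add,t2_space} \<Rightarrow> 'a"
  assumes \<phi>: "\<phi> \<in> cont_endomorphisms" and U: "compact_open_subgroup (U :: 'a set)"
  shows "endo_scale \<phi> > 0"
proof -
  obtain V where V: "compact_open_subgroup V" "endo_scale \<phi> = subgroup_index (\<phi> ` V) (V \<inter> \<phi> ` V)"
    using endo_scale_attained[OF U] by blast
  obtain S where S: "finite S" "card S = endo_scale \<phi>"
      "\<And>u. u \<in> V \<Longrightarrow> \<exists>s\<in>S. u - s \<in> V \<inter> \<phi> -` V"
    using subgroup_index_representatives[OF \<phi> V(1)] V(2) by metis
  have "0 \<in> V" using V(1) by (simp add: compact_open_subgroup_def)
  then have "S \<noteq> {}" using S(3) by blast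
  then show ?thesis using S(1,2) card_gt_0_iff by metis
qed

text \<open>Each cotrajectory of U is itself a compact open subgroup, so the index of the next one in it is at
least the scale, and the measures decay at least geometrically with this ratio.\<close>

lemma H_top_ge_ln_scale:
  fixes \<phi> :: "'a::{topological_ab_group_add,t2_space} \<Rightarrow> 'a"
  assumes \<mu>: "left_haar_measure \<mu>" and \<phi>: "\<phi> \<in> cont_endomorphisms" and U: "compact_open_subgroup U"
  shows "ereal (ln (real (endo_scale \<phi>))) \<le> H_top \<mu> \<phi> U"
proof -
  let ?C = "\<lambda>n. cotrajectory \<phi> U (Suc n)" and ?s = "endo_scale \<phi>"
  have C: "compact_open_subgroup (?C n)" for n
    by (rule compact_open_subgroup_cotrajectory[OF \<phi> U])
  note m = compact_open_subgroup_measure[OF \<mu> C]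
  have s: "real ?s > 0" using endo_scale_pos[OF \<phi> U] by simp
  have step: "real ?s * measure \<mu> (?C (Suc n)) \<le> measure \<mu> (?C n)" for n
  proof -
    obtain S where S: "finite S" "S \<subseteq> ?C n"
        "card S = subgroup_index (\<phi> ` ?C n) (?C n \<inter> \<phi> ` ?C n)"
        "\<And>u. u \<in> ?C n \<Longrightarrow> \<exists>s\<in>S. u - s \<in> ?C n \<inter> \<phi> -` ?C n"
        "\<And>s t. s \<in> S \<Longrightarrow> t \<in> S \<Longrightarrow> s \<noteq> t \<Longrightarrow> s - t \<notin> ?C n \<inter> \<phi> -` ?C n"
      by (rule subgroup_index_representatives[OF \<phi> C[of n]]) blast
    have "ennreal (real ?s * measure \<mu> (?C (Suc n))) = of_nat ?s * emeasure \<mu> (?C (Suc n))"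
      using m(1)[of "Suc n"] by (simp add: ennreal_mult ennreal_of_nat_eq_real_of_nat)
    also have "\<dots> \<le> of_nat (card S) * emeasure \<mu> (?C (Suc n))"
      using endo_scale_le[OF C[of n], of \<phi>] S(3) by (intro mult_right_mono) simp_all
    also have "\<dots> \<le> emeasure \<mu> (?C n)"
    proof (rule left_haar_measure_separated[OF \<mu> m(3) _ m(3)])
      show "additive_subgroup (?C (Suc n))" "additive_subgroup (?C n)"
        using C by (simp_all add: compact_open_subgroup_iff)
      show "?C (Suc n) \<subseteq> ?C n" by (simp add: cotrajectory_Suc_Suc)
      show "s - t \<notin> ?C (Suc n)" if "s \<in> S" "t \<in> S" "s \<noteq> t" for s t
        using S(5)[OF that] by (simp add: cotrajectory_Suc_Suc)
    qed (rule S)+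
    also have "\<dots> = ennreal (measure \<mu> (?C n))" by (rule m(1))
    finally show ?thesis by (simp add: ennreal_le_iff)
  qed
  have bound: "real ?s ^ n * measure \<mu> (?C n) \<le> measure \<mu> (?C 0)" for n
  proof (induction n)
    case (Suc n)
    have "real ?s ^ Suc n * measure \<mu> (?C (Suc n)) = real ?s ^ n * (real ?s * measure \<mu> (?C (Suc n)))"
      by simp
    also have "\<dots> \<le> real ?s ^ n * measure \<mu> (?C n)" by (intro mult_left_mono step) simp
    finally show ?case using Suc by simp
  qed simp
  have "real n * ln (real ?s) - ln (measure \<mu> (?C 0)) \<le> - ln (measure \<mu> (?C n))" for n
  proof -
    have "ln (real ?s ^ n * measure \<mu> (?C n)) \<le> ln (measure \<mu> (?C 0))"
      using bound[of n] m(2)[of n] s by (intro ln_mono) simp_all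
    moreover have "ln (real ?s ^ n * measure \<mu> (?C n)) = real n * ln (real ?s) + ln (measure \<mu> (?C n))"
      using m(2)[of n] s by (simp add: ln_mult ln_realpow)
    ultimately show ?thesis by simp
  qed
  then show ?thesis unfolding H_top_def by (rule limsup_quotient_bounds(1))
qed

text \<open>For a subgroup V that attains the scale the measures of the cotrajectories decay at most with this
ratio. The cotrajectories of another neighbourhood U contain the \<open>p ^ k\<close>-multiples of those of V,
whose index is bounded uniformly; so their measures are smaller at most by a constant factor, which
disappears in the limit.\<close>

lemma H_top_le_ln_scale:
  fixes \<phi> :: "'a::{topological_ab_group_add,t2_space} \<Rightarrow> 'a"
  assumes p: "prime p" and G: "lca_p_group p TYPE('a)" and rank: "rank_p p TYPE('a) < \<infinity>"
    and \<mu>: "left_haar_measure \<mu>" and \<phi>: "\<phi> \<in> cont_endomorphisms" and U: "U \<in> compact_nhds_0"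
  shows "H_top \<mu> \<phi> U \<le> ereal (ln (real (endo_scale \<phi>)))"
proof -
  note add = cont_endomorphismsD(1)[OF \<phi>] and cont = cont_endomorphismsD(3)[OF \<phi>]
  let ?s = "endo_scale \<phi>"
  obtain V0 :: "'a set" where V0: "compact_open_subgroup V0"
    using compact_open_subgroup_exists[OF G p] by blast
  then obtain V where V: "compact_open_subgroup V" and sV: "?s = subgroup_index (\<phi> ` V) (V \<inter> \<phi> ` V)"
    using endo_scale_attained by blast
  have s: "real ?s > 0" using endo_scale_pos[OF \<phi> V0] by simp
  have Vs: "compact V" "additive_subgroup V" using V by (simp_all add: compact_open_subgroup_iff)
  let ?C = "\<lambda>n. cotrajectory \<phi> V (Suc n)" and ?D = "\<lambda>n. cotrajectory \<phi> U (Suc n)"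
  have C: "compact_open_subgroup (?C n)" for n
    by (rule compact_open_subgroup_cotrajectory[OF \<phi> V])
  then have Cs: "compact (?C n)" "additive_subgroup (?C n)" for n
    by (simp_all add: compact_open_subgroup_iff)
  have CV: "?C n \<subseteq> V" for n by (auto simp: cotrajectory_def)
  note m = compact_open_subgroup_measure[OF \<mu> C]
  have cov: "covered_by_translates V (V \<inter> \<phi> -` V) ?s"
  proof -
    obtain S where S: "finite S" "S \<subseteq> V"
        "card S = subgroup_index (\<phi> ` V) (V \<inter> \<phi> ` V)"
        "\<And>u. u \<in> V \<Longrightarrow> \<exists>s\<in>S. u - s \<in> V \<inter> \<phi> -` V"
        "\<And>s t. s \<in> S \<Longrightarrow> t \<in> S \<Longrightarrow> s \<noteq> t \<Longrightarrow> s - t \<notin> V \<inter> \<phi> -` V"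
      by (rule subgroup_index_representatives[OF \<phi> V]) blast
    then show ?thesis unfolding covered_by_translates_def using sV by (intro exI[of _ S]) simp
  qed
  have step: "measure \<mu> (?C n) \<le> real ?s * measure \<mu> (?C (Suc n))" for n
  proof -
    \<comment> \<open>The map \<open>\<phi> ^^ n\<close> sends the cotrajectory into V, so the covering of V pulls back to it.\<close>
    have "covered_by_translates (?C n) (?C n \<inter> (\<phi> ^^ n) -` (V \<inter> \<phi> -` V)) ?s"
    proof (rule covered_by_translates_vimage[OF hom_funpow[OF add] cov _ Cs(2)])
      show "additive_subgroup (V \<inter> \<phi> -` V)"
        by (intro additive_subgroup_Int additive_subgroup_vimage add Vs)
      show "?C n \<subseteq> (\<phi> ^^ n) -` V" by (simp add: cotrajectory_Suc)
    qed
    moreover have "?C n \<inter> (\<phi> ^^ n) -` (V \<inter> \<phi> -` V) = ?C (Suc n)"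
      by (auto simp: cotrajectory_Suc)
    ultimately have "covered_by_translates (?C n) (?C (Suc n)) ?s" by simp
    from left_haar_measure_covered[OF \<mu> m(3) this]
    have "ennreal (measure \<mu> (?C n)) \<le> ennreal (real ?s * measure \<mu> (?C (Suc n)))"
      unfolding m(1) by (simp add: ennreal_mult ennreal_of_nat_eq_real_of_nat)
    then show ?thesis by (simp add: ennreal_le_iff)
  qed
  have bound: "measure \<mu> (?C 0) \<le> real ?s ^ n * measure \<mu> (?C n)" for n
  proof (induction n)
    case (Suc n)
    note Suc
    also have "real ?s ^ n * measure \<mu> (?C n) \<le> real ?s ^ n * (real ?s * measure \<mu> (?C (Suc n)))"
      by (intro mult_left_mono step) simp
    finally show ?case by (simp add: mult_ac)
  qed simp
  obtain K where K: "\<And>W. W \<subseteq> V \<Longrightarrow> compact W \<Longrightarrow> additive_subgroup W \<Longrightarrow>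
      covered_by_translates W (nat_mult p ` W) K"
    using covered_by_multiples_uniform[OF G p Vs(1) rank] by blast
  have U': "compact U" "0 \<in> interior U" using U by (simp_all add: compact_nhds_0_def)
  \<comment> \<open>Since \<open>\<phi>\<close> commutes with multiples, \<open>p ^ k V \<subseteq> U\<close> passes to all cotrajectories.\<close>
  obtain k where k: "\<And>x. x \<in> V \<Longrightarrow> nat_mult (p ^ k) x \<in> U"
    using prime_powers_tendsto_uniformly[OF G Vs(1) open_interior U'(2)] interior_subset by blast
  define D where "D = K ^ k"
  have Dfin: "emeasure \<mu> (?D n) = ennreal (measure \<mu> (?D n))" and Dmeas: "?D n \<in> sets \<mu>" for n
  proof -
    have cl: "closed (?D n)" unfolding cotrajectory_def
      by (intro closed_INT ballI closed_vimage compact_imp_closed U' cont)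
    then show "?D n \<in> sets \<mu>" by (simp add: left_haar_measure_sets[OF \<mu>])
    have "?D n \<subseteq> U" by (auto simp: cotrajectory_def)
    then have "compact (?D n)" using compact_Int_closed[OF U'(1) cl] by (simp add: Int_absorb1)
    then have "emeasure \<mu> (?D n) < \<infinity>" by (rule left_haar_measure_compact[OF \<mu>])
    then show "emeasure \<mu> (?D n) = ennreal (measure \<mu> (?D n))" by (simp add: emeasure_eq_ennreal_measure)
  qed
  have compare: "measure \<mu> (?C n) \<le> real D * measure \<mu> (?D n)" for n
  proof -
    have "covered_by_translates (?C n) (nat_mult (p ^ k) ` ?C n) D"
      unfolding D_def by (rule covered_by_prime_power_multiples[OF K CV Cs])
    moreover have "nat_mult (p ^ k) ` ?C n \<in> sets borel"
      by (intro borel_compact compact_nat_mult Cs)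
    ultimately have "emeasure \<mu> (?C n) \<le> of_nat D * emeasure \<mu> (nat_mult (p ^ k) ` ?C n)"
      by (intro left_haar_measure_covered[OF \<mu>])
    also have "\<dots> \<le> of_nat D * emeasure \<mu> (?D n)"
    proof (intro mult_left_mono emeasure_mono Dmeas)
      have "(\<phi> ^^ i) (nat_mult (p ^ k) x) = nat_mult (p ^ k) ((\<phi> ^^ i) x)" for i x
        by (rule nat_mult_hom) (rule hom_funpow[OF add])
      then show "nat_mult (p ^ k) ` ?C n \<subseteq> ?D n"
        using k by (auto simp: cotrajectory_def)
    qed simp
    finally have "ennreal (measure \<mu> (?C n)) \<le> ennreal (real D * measure \<mu> (?D n))"
      unfolding m(1) Dfin by (simp add: ennreal_mult ennreal_of_nat_eq_real_of_nat)
    then show ?thesis by (simp add: ennreal_le_iff)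
  qed
  have Dpos: "real D > 0" "measure \<mu> (?D n) > 0" for n
    using compare[of n] m(2)[of n] by (auto simp: zero_less_mult_iff dest: less_le_trans)
  have "- ln (measure \<mu> (?D n)) \<le> real n * ln (real ?s) - (ln (measure \<mu> (?C 0)) - ln (real D))" for n
  proof -
    have "measure \<mu> (?C 0) \<le> real ?s ^ n * (real D * measure \<mu> (?D n))"
      using bound[of n] mult_left_mono[OF compare[of n], of "real ?s ^ n"] by simp
    then have "ln (measure \<mu> (?C 0)) \<le> ln (real ?s ^ n * (real D * measure \<mu> (?D n)))"
      using m(2)[of 0] by (intro ln_mono) simp_all
    also have "\<dots> = real n * ln (real ?s) + (ln (real D) + ln (measure \<mu> (?D n)))"
      using Dpos(1) Dpos(2)[of n] s by (simp add: ln_mult ln_realpow)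
    finally show ?thesis by simp
  qed
  then show ?thesis unfolding H_top_def by (rule limsup_quotient_bounds(2))
qed

theorem theorem1p7:
  fixes p :: nat
    and \<mu> :: "'a::{topological_ab_group_add,t2_space} measure"
    and \<phi> :: "'a \<Rightarrow> 'a"
  assumes "prime p"
    and "lca_p_group p TYPE('a)"
    and "rank_p p TYPE('a) < \<infinity>"
    and "left_haar_measure \<mu>"
    and "\<phi> \<in> cont_endomorphisms"
  shows "h_top \<mu> \<phi> = ereal (ln (real (endo_scale \<phi>)))"
proof (rule antisym)
  show "h_top \<mu> \<phi> \<le> ereal (ln (real (endo_scale \<phi>)))"
    unfolding h_top_def by (intro SUP_least H_top_le_ln_scale[OF assms])
  obtain U :: "'a set" where U: "compact_open_subgroup U"
    using compact_open_subgroup_exists[OF assms(2,1)] by blast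
  have "U \<in> compact_nhds_0"
    using U by (simp add: compact_nhds_0_def compact_open_subgroup_def interior_open)
  then have "H_top \<mu> \<phi> U \<le> h_top \<mu> \<phi>" unfolding h_top_def by (rule SUP_upper)
  with H_top_ge_ln_scale[OF assms(4,5) U] show "ereal (ln (real (endo_scale \<phi>))) \<le> h_top \<mu> \<phi>"
    by (rule order_trans)
qed

end
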